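(* Let $\Omega\subset\mathbb{R}^{n_p}$ be a parameter domain, let $r,n_u,n_y,\kappa\in\mathbb{N}$, and let $H:\overline{\mathbb{C}^+}\times\Omega\to\mathbb{C}^{n_y\times n_u}$ be a given (full-order) transfer function. Consider the parameterized reduced transfer function $$H_r(s,p;\theta)=\mathcal{C}_r(p,\theta)\big(sI-\mathcal{A}_r(p,\theta)\big)^{-1}\mathcal{B}_r(p,\theta)+\mathcal{D}_r(p,\theta),\qquad \mathcal{A}_r=(\mathcal{J}_r-\mathcal{R}_r)\mathcal{Q}_r,$$ where, for $\theta$ partitioned as $\theta=[\theta_{B_1}^\top,\dots,\theta_{B_\kappa}^\top,\theta_{C_1}^\top,\dots,\theta_{C_\kappa}^\top,\theta_{D_1}^\top,\dots,\theta_{D_\kappa}^\top,\theta_{J_1}^\top,\dots,\theta_{J_\kappa}^\top,\theta_{R_1}^\top,\dots,\theta_{R_\kappa}^\top,\theta_{Q_1}^\top,\dots,\theta_{Q_\kappa}^\top]^\top$ with $\theta_{B_i}\in\mathbb{R}^{rn_u}$, $\theta_{C_i}\in\mathbb{R}^{n_yr}$, $\theta_{D_i}\in\mathbb{R}^{n_yn_u}$, $\theta_{J_i}\in\mathbb{R}^{r(r-1)/2}$, $\theta_{R_i},\theta_{Q_i}\in\mathbb{R}^{r(r+1)/2}$, $$\mathcal{B}_r(p,\theta)=\sum_{i=1}^\kappa f_i^B(p)B_i(\theta),\ \mathcal{C}_r(p,\theta)=\sum_{i=1}^\kappa f_i^C(p)C_i(\theta),\ \mathcal{D}_r(p,\theta)=\sum_{i=1}^\kappa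 f_i^D(p)D_i(\theta),$$ $$\mathcal{J}_r(p,\theta)=\sum_{i=1}^\kappa f_i^J(p)J_i(\theta),\ \mathcal{R}_r(p,\theta)=\sum_{i=1}^\kappa f_i^R(p)R_i(\theta),\ \mathcal{Q}_r(p,\theta)=\sum_{i=1}^\kappa f_i^Q(p)Q_i(\theta),$$ with real-valued scalar functions $f_i^B,f_i^C,f_i^D,f_i^J,f_i^R,f_i^Q$ on $\Omega$, and $B_i(\theta)\in\mathbb{R}^{r\times n_u}$, $C_i(\theta)\in\mathbb{R}^{n_y\times r}$, $D_i(\theta)\in\mathbb{R}^{n_y\times n_u}$ the matrices whose column-major vectorizations are $\theta_{B_i},\theta_{C_i},\theta_{D_i}$, respectively; $J_i(\theta)=\mathrm{vtsu}(\theta_{J_i})-\mathrm{vtsu}(\theta_{J_i})^\top$; $R_i(\theta)=\mathrm{vtu}(\theta_{R_i})\mathrm{vtu}(\theta_{R_i})^\top$; $Q_i(\theta)=\mathrm{vtu}(\theta_{Q_i})\mathrm{vtu}(\theta_{Q_i})^\top$. Let $\theta_0\in\mathbb{R}^{n_\theta}$, $s_0\in\overline{\mathbb{C}^+}$, and $p^{(0)}\in\Omega$ be given, and assume $\Delta:=s_0I-\mathcal{A}_r(p^{(0)},\theta_0)$ is invertible. Assume that the $j$-th singular value of $H(s_0,p^{(0)})-H_r(s_0,p^{(0)};\theta_0)$ is nonzero and simple, and let $u$ and $v$ be corresponding left and right singular vectors, respectively. Then the function $\theta\mapsto\sigma_j\big(H(s_0,p^{(0)})-H_r(s_0,p^{(0)};\theta)\big)$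 is differentiable in a neighborhood of $\theta_0$, and its gradient at $\theta_0$, partitioned conformally with $\theta$ into blocks $\mathrm{d}\theta_{B_k},\mathrm{d}\theta_{C_k},\mathrm{d}\theta_{D_k},\mathrm{d}\theta_{J_k},\mathrm{d}\theta_{R_k},\mathrm{d}\theta_{Q_k}$ ($k=1,\dots,\kappa$), is given by $$\mathrm{d}\theta_{B_k}=-\mathrm{Re}\,\mathrm{ftv}\Big(\big(v u^{H}\mathcal{C}_r(p^{(0)},\theta_0)\Delta^{-1}f_k^B(p^{(0)})\big)^\top\Big),$$ $$\mathrm{d}\theta_{C_k}=-\mathrm{Re}\,\mathrm{ftv}\Big(\big(\Delta^{-1}\mathcal{B}_r(p^{(0)},\theta_0)v u^{H}f_k^C(p^{(0)})\big)^\top\Big),$$ $$\mathrm{d}\theta_{D_k}=-\mathrm{Re}\,\mathrm{ftv}\Big(\big(v u^{H}f_k^D(p^{(0)})\big)^\top\Big),$$ $$\mathrm{d}\theta_{R_k}=\mathrm{Re}\,\mathrm{utv}\Big(Y_1f_k^R(p^{(0)})\,\mathrm{vtu}(\theta_{0,R_k})+\big(Y_1f_k^R(p^{(0)})\big)^\top\mathrm{vtu}(\theta_{0,R_k})\Big),$$ $$\mathrm{d}\theta_{J_k}=\mathrm{Re}\Big(\mathrm{sutv}\big(Y_1f_k^J(p^{(0)})\big)-\mathrm{sutv}\big((Y_1f_k^J(p^{(0)}))^\top\big)\Big),$$ $$\mathrm{d}\theta_{Q_k}=-\mathrm{Re}\,\mathrm{utv}\Big(\big(Y_2f_k^Q(p^{(0)})\big)^\top\mathrm{vtu}(\theta_{0,Q_k})+Y_2f_k^Q(p^{(0)})\,\mathrm{vtu}(\theta_{0,Q_k})\Big),$$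 where $\theta_{0,R_k},\theta_{0,Q_k}$ denote the corresponding blocks of $\theta_0$ and $$Y_1=\mathcal{Q}_r(p^{(0)},\theta_0)\Delta^{-1}\mathcal{B}_r(p^{(0)},\theta_0)v u^{H}\mathcal{C}_r(p^{(0)},\theta_0)\Delta^{-1},$$ $$Y_2=\Delta^{-1}\mathcal{B}_r(p^{(0)},\theta_0)v u^{H}\mathcal{C}_r(p^{(0)},\theta_0)\Delta^{-1}\big(\mathcal{J}_r(p^{(0)},\theta_0)-\mathcal{R}_r(p^{(0)},\theta_0)\big).$$
   Context: $\overline{\mathbb{C}^+}$ denotes the closed right half-plane. Reshaping operations: $\mathrm{ftv}(A)$ is the column-major vectorization of a matrix $A$ (i.e. $[a_{11},a_{21},\dots,a_{n1},a_{12},\dots,a_{nm}]^\top$). For $v\in\mathbb{C}^{n(n+1)/2}$, $\mathrm{vtu}(v)$ is the $n\times n$ upper triangular matrix whose upper triangle is filled row by row with the entries of $v$ (first row $v_1,\dots,v_n$, second row from the diagonal $v_{n+1},\dots,v_{2n-1}$, etc.), and $\mathrm{utv}(A)=[a_{11},a_{12},\dots,a_{1n},a_{22},\dots,a_{nn}]^\top$ extracts the upper triangle of $A$ row by row. For $v\in\mathbb{C}^{n(n-1)/2}$, $\mathrm{vtsu}(v)$ is the $n\times n$ strictly upper triangular matrix whose strictly upper triangle is filled row by row with $v$, and $\mathrm{sutv}(A)=[a_{12},a_{13},\dots,a_{1n},a_{23},\dots,a_{n-1,n}]^\top$. $\sigma_j(\cdot)$ denotes the $j$-th singular value; $u^H$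 is the conjugate transpose; $\mathrm{Re}$ is taken entrywise. *)

theory Defs
  imports "HOL-Analysis.Analysis" "HOL-Computational_Algebra.Fundamental_Theorem_Algebra"
    "HOL-Library.Multiset"
    "Jordan_Normal_Form.Char_Poly" "Jordan_Normal_Form.Gauss_Jordan_Elimination"
begin

definition cadj :: "complex mat \<Rightarrow> complex mat" where
  "cadj M = mat (dim_col M) (dim_row M) (\<lambda>(i,j). cnj (M $$ (j,i)))"

definition minv :: "complex mat \<Rightarrow> complex mat" where
  "minv A = (case mat_inverse A of Some B \<Rightarrow> B | None \<Rightarrow> 0\<^sub>m (dim_row A) (dim_row A))"

definition cm :: "real mat \<Rightarrow> complex mat" where
  "cm M = map_mat complex_of_real M"

definition sing_vals :: "complex mat \<Rightarrow> real list" where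
  "sing_vals M = rev (sorted_list_of_multiset
      (image_mset (\<lambda>z. sqrt (Re z)) (proots (char_poly (cadj M * M)))))"

definition sigma :: "nat \<Rightarrow> complex mat \<Rightarrow> real" where
  "sigma j M = sing_vals M ! (j - 1)"

definition vnorm2 :: "complex vec \<Rightarrow> real" where
  "vnorm2 w = (\<Sum>i<dim_vec w. (cmod (w $ i))\<^sup>2)"

definition sing_vec_pair :: "complex mat \<Rightarrow> real \<Rightarrow> complex vec \<Rightarrow> complex vec \<Rightarrow> bool" where
  "sing_vec_pair M s u v \<longleftrightarrow>
     u \<in> carrier_vec (dim_row M) \<and> v \<in> carrier_vec (dim_col M) \<and>
     vnorm2 u = 1 \<and> vnorm2 v = 1 \<and>
     M *\<^sub>v v = complex_of_real s \<cdot>\<^sub>v u \<and> cadj M *\<^sub>v u = complex_of_real s \<cdot>\<^sub>v v"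

definition ftv :: "'a mat \<Rightarrow> 'a list" where
  "ftv M = concat (map (\<lambda>b. map (\<lambda>a. M $$ (a,b)) [0..<dim_row M]) [0..<dim_col M])"

definition vtm :: "nat \<Rightarrow> nat \<Rightarrow> (nat \<Rightarrow> 'a) \<Rightarrow> 'a mat" where
  "vtm m n w = mat m n (\<lambda>(a,b). w (b * m + a))"

text \<open>Row-by-row position of entry (a,b), a \<le> b, in the upper triangle of an n x n matrix,
  and of entry (a,b), a < b, in the strict upper triangle.\<close>
definition utidx :: "nat \<Rightarrow> nat \<Rightarrow> nat \<Rightarrow> nat" where
  "utidx n a b = (\<Sum>t<a. n - t) + (b - a)"

definition sutidx :: "nat \<Rightarrow> nat \<Rightarrow> nat \<Rightarrow> nat" where
  "sutidx n a b = (\<Sum>t<a. n - 1 - t) + (b - a - 1)"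

definition vtu :: "nat \<Rightarrow> (nat \<Rightarrow> 'a::zero) \<Rightarrow> 'a mat" where
  "vtu n w = mat n n (\<lambda>(a,b). if a \<le> b then w (utidx n a b) else 0)"

definition vtsu :: "nat \<Rightarrow> (nat \<Rightarrow> 'a::zero) \<Rightarrow> 'a mat" where
  "vtsu n w = mat n n (\<lambda>(a,b). if a < b then w (sutidx n a b) else 0)"

definition utv :: "'a mat \<Rightarrow> 'a list" where
  "utv M = concat (map (\<lambda>a. map (\<lambda>b. M $$ (a,b)) [a..<dim_col M]) [0..<dim_row M])"

definition sutv :: "'a mat \<Rightarrow> 'a list" where
  "sutv M = concat (map (\<lambda>a. map (\<lambda>b. M $$ (a,b)) [Suc a..<dim_col M]) [0..<dim_row M])"

definition nB :: "nat \<Rightarrow> nat \<Rightarrow> nat" where "nB r nu = r * nu"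
definition nC :: "nat \<Rightarrow> nat \<Rightarrow> nat" where "nC r ny = ny * r"
definition nD :: "nat \<Rightarrow> nat \<Rightarrow> nat" where "nD nu ny = ny * nu"
definition nJ :: "nat \<Rightarrow> nat" where "nJ r = r * (r - 1) div 2"
definition nRQ :: "nat \<Rightarrow> nat" where "nRQ r = r * (r + 1) div 2"

definition offB where "offB r nu ny \<kappa> i = i * nB r nu"
definition offC where "offC r nu ny \<kappa> i = \<kappa> * nB r nu + i * nC r ny"
definition offD where "offD r nu ny \<kappa> i = \<kappa> * (nB r nu + nC r ny) + i * nD nu ny"
definition offJ where "offJ r nu ny \<kappa> i = \<kappa> * (nB r nu + nC r ny + nD nu ny) + i * nJ r"
definition offR where
  "offR r nu ny \<kappa> i = \<kappa> * (nB r nu + nC r ny + nD nu ny + nJ r) + i * nRQ r"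
definition offQ where
  "offQ r nu ny \<kappa> i = \<kappa> * (nB r nu + nC r ny + nD nu ny + nJ r + nRQ r) + i * nRQ r"
definition ntheta :: "nat \<Rightarrow> nat \<Rightarrow> nat \<Rightarrow> nat \<Rightarrow> nat" where
  "ntheta r nu ny \<kappa> = \<kappa> * (nB r nu + nC r ny + nD nu ny + nJ r + 2 * nRQ r)"

definition blk :: "(nat \<Rightarrow> real) \<Rightarrow> nat \<Rightarrow> nat \<Rightarrow> real" where
  "blk \<theta> off = (\<lambda>k. \<theta> (off + k))"

definition Bi where "Bi r nu ny \<kappa> \<theta> i = vtm r nu (blk \<theta> (offB r nu ny \<kappa> i))"
definition Ci where "Ci r nu ny \<kappa> \<theta> i = vtm ny r (blk \<theta> (offC r nu ny \<kappa> i))"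
definition Di where "Di r nu ny \<kappa> \<theta> i = vtm ny nu (blk \<theta> (offD r nu ny \<kappa> i))"
definition Ji where "Ji r nu ny \<kappa> \<theta> i =
  vtsu r (blk \<theta> (offJ r nu ny \<kappa> i)) - transpose_mat (vtsu r (blk \<theta> (offJ r nu ny \<kappa> i)))"
definition Ri where "Ri r nu ny \<kappa> \<theta> i =
  vtu r (blk \<theta> (offR r nu ny \<kappa> i)) * transpose_mat (vtu r (blk \<theta> (offR r nu ny \<kappa> i)))"
definition Qi where "Qi r nu ny \<kappa> \<theta> i =
  vtu r (blk \<theta> (offQ r nu ny \<kappa> i)) * transpose_mat (vtu r (blk \<theta> (offQ r nu ny \<kappa> i)))"

definition pcomb :: "nat \<Rightarrow> nat \<Rightarrow> nat \<Rightarrow> (nat \<Rightarrow> 'p \<Rightarrow> real) \<Rightarrow> 'p \<Rightarrow> (nat \<Rightarrow> real mat) \<Rightarrow> real mat" where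
  "pcomb m n \<kappa> f p M = mat m n (\<lambda>ij. \<Sum>i<\<kappa>. f i p * M i $$ ij)"

definition Brp where "Brp r nu ny \<kappa> fB p \<theta> = pcomb r nu \<kappa> fB p (Bi r nu ny \<kappa> \<theta>)"
definition Crp where "Crp r nu ny \<kappa> fC p \<theta> = pcomb ny r \<kappa> fC p (Ci r nu ny \<kappa> \<theta>)"
definition Drp where "Drp r nu ny \<kappa> fD p \<theta> = pcomb ny nu \<kappa> fD p (Di r nu ny \<kappa> \<theta>)"
definition Jrp where "Jrp r nu ny \<kappa> fJ p \<theta> = pcomb r r \<kappa> fJ p (Ji r nu ny \<kappa> \<theta>)"
definition Rrp where "Rrp r nu ny \<kappa> fR p \<theta> = pcomb r r \<kappa> fR p (Ri r nu ny \<kappa> \<theta>)"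
definition Qrp where "Qrp r nu ny \<kappa> fQ p \<theta> = pcomb r r \<kappa> fQ p (Qi r nu ny \<kappa> \<theta>)"

definition Arp where "Arp r nu ny \<kappa> fJ fR fQ p \<theta> =
  (Jrp r nu ny \<kappa> fJ p \<theta> - Rrp r nu ny \<kappa> fR p \<theta>) * Qrp r nu ny \<kappa> fQ p \<theta>"

definition Hr where "Hr r nu ny \<kappa> fB fC fD fJ fR fQ s p \<theta> =
  cm (Crp r nu ny \<kappa> fC p \<theta>) * minv (s \<cdot>\<^sub>m 1\<^sub>m r - cm (Arp r nu ny \<kappa> fJ fR fQ p \<theta>))
     * cm (Brp r nu ny \<kappa> fB p \<theta>) + cm (Drp r nu ny \<kappa> fD p \<theta>)"


definition outer_vuH :: "complex vec \<Rightarrow> complex vec \<Rightarrow> complex mat" where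
  "outer_vuH v u = mat (dim_vec v) (dim_vec u) (\<lambda>(a,b). v $ a * cnj (u $ b))"

definition grad_formula where
  "grad_formula r nu ny \<kappa> fB fC fD fJ fR fQ s0 p0 \<theta>0 u v =
   (let Br = cm (Brp r nu ny \<kappa> fB p0 \<theta>0); Cr = cm (Crp r nu ny \<kappa> fC p0 \<theta>0);
        Jr = cm (Jrp r nu ny \<kappa> fJ p0 \<theta>0); Rr = cm (Rrp r nu ny \<kappa> fR p0 \<theta>0);
        Qr = cm (Qrp r nu ny \<kappa> fQ p0 \<theta>0);
        Di = minv (s0 \<cdot>\<^sub>m 1\<^sub>m r - cm (Arp r nu ny \<kappa> fJ fR fQ p0 \<theta>0));
        W = outer_vuH v u;
        Y1 = Qr * Di * Br * W * Cr * Di;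
        Y2 = Di * Br * W * Cr * Di * (Jr - Rr);
        c = complex_of_real;
        LR = (\<lambda>k. cm (vtu r (blk \<theta>0 (offR r nu ny \<kappa> k))));
        LQ = (\<lambda>k. cm (vtu r (blk \<theta>0 (offQ r nu ny \<kappa> k))));
        dB = (\<lambda>k. map (\<lambda>z. - Re z) (ftv (transpose_mat (W * Cr * Di * (c (fB k p0) \<cdot>\<^sub>m 1\<^sub>m r)))));
        dC = (\<lambda>k. map (\<lambda>z. - Re z) (ftv (transpose_mat (Di * Br * W * (c (fC k p0) \<cdot>\<^sub>m 1\<^sub>m ny)))));
        dD = (\<lambda>k. map (\<lambda>z. - Re z) (ftv (transpose_mat (c (fD k p0) \<cdot>\<^sub>m W))));
        dJ = (\<lambda>k. map2 (\<lambda>a b. Re (a - b)) (sutv (c (fJ k p0) \<cdot>\<^sub>m Y1))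
                                          (sutv (transpose_mat (c (fJ k p0) \<cdot>\<^sub>m Y1))));
        dR = (\<lambda>k. map Re (utv ((c (fR k p0) \<cdot>\<^sub>m Y1) * LR k
                              + transpose_mat (c (fR k p0) \<cdot>\<^sub>m Y1) * LR k)));
        dQ = (\<lambda>k. map (\<lambda>z. - Re z) (utv (transpose_mat (c (fQ k p0) \<cdot>\<^sub>m Y2) * LQ k
                              + (c (fQ k p0) \<cdot>\<^sub>m Y2) * LQ k)))
    in concat (map dB [0..<\<kappa>]) @ concat (map dC [0..<\<kappa>]) @ concat (map dD [0..<\<kappa>])
       @ concat (map dJ [0..<\<kappa>]) @ concat (map dR [0..<\<kappa>]) @ concat (map dQ [0..<\<kappa>]))"

end

theory Submission
  imports Defs
begin

text \<open>
  Write \<open>N y\<close> for the Gram matrix \<open>M y\<^sup>H M y\<close> of the error \<open>M y\<close>, with ordered eigenvalues \<open>\<sigma>\<^sub>i\<^sup>2\<close>.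
  The ordered singular values are continuous: along any convergent sequence they have convergent
  subsequences, and the limits are the roots of the limiting characteristic polynomial. Hence
  \<open>\<sigma>\<^sub>j\<close> stays simple and nonzero nearby.

  At a simple eigenvalue \<open>\<lambda> = \<sigma>\<^sub>j\<^sup>2\<close> the derivative of the characteristic polynomial is a sum of principal
  minors of \<open>\<lambda> - N x\<close>, so one of them is nonzero, and the corresponding row of cofactors of
  \<open>\<lambda> y - N y\<close> is an eigenvector \<open>w y\<close> that is continuous in \<open>y\<close> with \<open>w x\<close> parallel to \<open>v\<close>. As \<open>N x\<close> is Hermitian,
  \<open>(\<lambda> y - \<lambda> x) (v\<^sup>H w y) = v\<^sup>H (N y - N x) w y\<close>, and letting \<open>y \<rightarrow> x\<close> gives the derivative of \<open>\<lambda>\<close>,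
  whence that of \<open>\<sigma>\<^sub>j\<close> is \<open>Re (u\<^sup>H M' v) = Re (tr (v u\<^sup>H M'))\<close>.
  The block formulas follow by differentiating \<open>H\<^sub>r\<close> and cycling the trace.
\<close>

unbundle no vec_syntax

section \<open>Continuity of singular values\<close>

text \<open>Matrices whose dimensions are terms carry no norm, so all limits and derivatives are
  taken entry by entry. \<open>sigma\<close> is a position in a sorted list of polynomial roots and
  has no formula to differentiate; its continuity has to come from compactness, with the order of
  the list passing to the limit so that each position converges separately. The eigenvector made of
  cofactors needs neither a normalisation nor a derivative: its scale cancels in the quotient by v^H
  w, and it only multiplies the increment N y - N x, which vanishes at x, so that a factor with a
  limit suffices. The same product rule handles the matrix inverse. Differentiability near
  \<theta>0, and not only at it, comes from arguing at an arbitrary point where the resolvent exists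
  and the singular value is simple and nonzero, all open conditions; there an eigenvector of the
  Gram matrix replaces the given singular pair. That the value is nonzero enters when the square
  root recovers it from its square.\<close>

lemma tendsto_det:
  fixes A :: "'b \<Rightarrow> 'a::{comm_ring_1,real_normed_algebra_1} mat"
  assumes "\<And>x. A x \<in> carrier_mat n n" "A0 \<in> carrier_mat n n"
    and "\<And>i j. i < n \<Longrightarrow> j < n \<Longrightarrow> ((\<lambda>x. A x $$ (i,j)) \<longlongrightarrow> A0 $$ (i,j)) F"
  shows "((\<lambda>x. Determinant.det (A x)) \<longlongrightarrow> Determinant.det A0) F"
proof -
  have "i < n \<Longrightarrow> p permutes {0..<n} \<Longrightarrow> p i < n" for i p
    using permutes_in_image[of p "{0..<n}" i] by simp
  then show ?thesis
    unfolding det_def'[OF assms(1)] det_def'[OF assms(2)]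
    by (intro tendsto_sum tendsto_mult tendsto_const tendsto_prod assms(3)) auto
qed

lemma index_mult_sum:
  assumes "A \<in> carrier_mat m k" "B \<in> carrier_mat k n" "a < m" "b < n"
  shows "(A * B) $$ (a,b) = (\<Sum>c<k. A $$ (a,c) * B $$ (c,b))"
  using assms by (auto simp: scalar_prod_def lessThan_atLeast0 intro!: sum.cong)

section \<open>Gram matrices, their eigenvalues and the singular values\<close>

lemma cadj_carrier: "M \<in> carrier_mat m n \<Longrightarrow> cadj M \<in> carrier_mat n m"
  by (auto simp: cadj_def)

lemma gram_carrier: "M \<in> carrier_mat m n \<Longrightarrow> cadj M * M \<in> carrier_mat n n"
  using cadj_carrier by (metis mult_carrier_mat)

lemma gram_index:
  assumes "M \<in> carrier_mat m n" "a < n" "b < n"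
  shows "(cadj M * M) $$ (a,b) = (\<Sum>c<m. cnj (M $$ (c,a)) * M $$ (c,b))"
  using assms by (subst index_mult_sum[OF cadj_carrier]) (auto simp: cadj_def intro!: sum.cong)

text \<open>Eigenvectors are handled as functions on indices from here on, so that limits, cofactors
  and derivatives combine coordinate by coordinate.\<close>

lemma eigenvalue_coords:
  fixes N :: "'a::field mat"
  assumes N: "N \<in> carrier_mat n n" and z: "poly (char_poly N) z = 0"
  obtains w where "\<exists>a<n. w a \<noteq> 0" "\<And>a. a < n \<Longrightarrow> (\<Sum>b<n. N $$ (a,b) * w b) = z * w a"
proof -
  from z eigenvalue_root_char_poly[OF N] obtain v where "eigenvector N v z"
    by (auto simp: eigenvalue_def)
  then have v: "v \<in> carrier_vec n" "v \<noteq> 0\<^sub>v n" "N *\<^sub>v v = z \<cdot>\<^sub>v v"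
    using N by (auto simp: eigenvector_def)
  have "\<exists>a<n. v $ a \<noteq> 0"
    using v(1,2) by (auto simp: vec_eq_iff)
  moreover have "(\<Sum>b<n. N $$ (a,b) * v $ b) = z * v $ a" if "a < n" for a
    using arg_cong[OF v(3), of "\<lambda>w. w $ a"] that v(1) N
    by (simp add: scalar_prod_def lessThan_atLeast0)
  ultimately show thesis by (rule that)
qed

text \<open>This is w^H (M^H M) w = ||M w||^2, the source of positive semidefiniteness.\<close>

lemma gram_quadratic:
  assumes "M \<in> carrier_mat m n"
  shows "(\<Sum>a<n. cnj (w a) * (\<Sum>b<n. (cadj M * M) $$ (a,b) * w b))
    = (\<Sum>c<m. complex_of_real ((cmod (\<Sum>b<n. M $$ (c,b) * w b))\<^sup>2))"
proof -
  have "(\<Sum>a<n. cnj (w a) * (\<Sum>b<n. (cadj M * M) $$ (a,b) * w b))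
      = (\<Sum>a<n. \<Sum>b<n. \<Sum>c<m. cnj (w a) * (cnj (M $$ (c,a)) * M $$ (c,b) * w b))"
    by (intro sum.cong refl) (simp add: gram_index[OF assms] sum_distrib_left sum_distrib_right)
  also have "\<dots> = (\<Sum>c<m. \<Sum>a<n. \<Sum>b<n. cnj (w a) * (cnj (M $$ (c,a)) * M $$ (c,b) * w b))"
    by (simp only: sum.swap[of _ "{..<m}"])
  also have "\<dots> = (\<Sum>c<m. cnj (\<Sum>b<n. M $$ (c,b) * w b) * (\<Sum>b<n. M $$ (c,b) * w b))"
    unfolding cnj_sum sum_product by (intro sum.cong refl) (simp add: mult_ac)
  also have "\<dots> = (\<Sum>c<m. complex_of_real ((cmod (\<Sum>b<n. M $$ (c,b) * w b))\<^sup>2))"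
    by (intro sum.cong refl) (simp only: complex_norm_square[symmetric] mult.commute)
  finally show ?thesis .
qed

text \<open>An eigenvector w gives z ||w||^2 = ||M w||^2, so z is a Rayleigh quotient: a nonnegative
  real over a positive one.\<close>

lemma gram_eigenvalue_nonneg:
  assumes M: "M \<in> carrier_mat m n" and z: "poly (char_poly (cadj M * M)) z = 0"
  shows "z = complex_of_real (Re z)" "0 \<le> Re z"
proof -
  obtain w where w: "\<exists>a<n. w a \<noteq> 0"
    "\<And>a. a < n \<Longrightarrow> (\<Sum>b<n. (cadj M * M) $$ (a,b) * w b) = z * w a"
    using eigenvalue_coords[OF gram_carrier[OF M] z] by blast
  define S where "S = (\<Sum>a<n. (cmod (w a))\<^sup>2)"
  define T where "T = (\<Sum>c<m. (cmod (\<Sum>b<n. M $$ (c,b) * w b))\<^sup>2)"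
  have S: "0 < S"
    using w(1) unfolding S_def by (auto intro!: sum_pos2)
  have T: "0 \<le> T"
    unfolding T_def by (intro sum_nonneg) auto
  have "(\<Sum>a<n. cnj (w a) * (z * w a)) = (\<Sum>c<m. complex_of_real ((cmod (\<Sum>b<n. M $$ (c,b) * w b))\<^sup>2))"
    using gram_quadratic[OF M, of w] w(2) by simp
  also have "\<dots> = complex_of_real T"
    by (simp add: T_def)
  also have "(\<Sum>a<n. cnj (w a) * (z * w a)) = z * complex_of_real S"
    unfolding S_def of_real_sum sum_distrib_left
    by (intro sum.cong refl) (simp only: complex_norm_square mult_ac)
  finally have "z = complex_of_real (T / S)"
    using S by (simp add: field_simps)
  then show "z = complex_of_real (Re z)" "0 \<le> Re z"
    using S T by (simp_all)
qed

lemma sing_vals_mset: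
  "mset (sing_vals M) = image_mset (\<lambda>z. sqrt (Re z)) (proots (char_poly (cadj M * M)))"
  by (simp add: sing_vals_def)

lemma char_poly_nonzero:
  "N \<in> carrier_mat n n \<Longrightarrow> char_poly (N :: 'a::comm_ring_1 mat) \<noteq> 0"
  using degree_monic_char_poly[of N n] by auto

text \<open>\<open>sing_vals\<close> takes real parts and then square roots. As the eigenvalues of a
  Gram matrix are nonnegative reals, squaring undoes both, with multiplicities.\<close>

lemma sing_vals_sq_mset:
  assumes M: "M \<in> carrier_mat m n"
  shows "image_mset (\<lambda>s. complex_of_real (s\<^sup>2)) (mset (sing_vals M)) = proots (char_poly (cadj M * M))"
proof -
  have "complex_of_real ((sqrt (Re z))\<^sup>2) = z" if "z \<in># proots (char_poly (cadj M * M))" for z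
    using that gram_eigenvalue_nonneg[OF M, of z] char_poly_nonzero[OF gram_carrier[OF M]] by simp
  then show ?thesis
    unfolding sing_vals_mset multiset.map_comp o_def by (intro multiset.map_ident_strong)
qed

lemma sing_vals_nonneg:
  assumes "M \<in> carrier_mat m n" "s \<in> set (sing_vals M)"
  shows "0 \<le> s"
proof -
  have "s \<in># mset (sing_vals M)" using assms by simp
  then show ?thesis
    unfolding sing_vals_mset
    using gram_eigenvalue_nonneg[OF assms(1)] char_poly_nonzero[OF gram_carrier[OF assms(1)]] by auto
qed

lemma length_sing_vals:
  assumes "M \<in> carrier_mat m n"
  shows "length (sing_vals M) = n"
proof -
  have "length (sing_vals M) = size (mset (sing_vals M))" by simp
  also have "\<dots> = n"
    unfolding sing_vals_mset using degree_monic_char_poly[OF gram_carrier[OF assms]]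
    by (simp add: size_proots_complex)
  finally show ?thesis .
qed

lemma sorted_rev_sing_vals: "sorted (rev (sing_vals M))"
  by (simp add: sing_vals_def)

text \<open>The characteristic polynomial is monic and splits over the complex numbers. Its value at
  a point thus becomes a continuous function of the singular values, which is how their limits are
  identified later.\<close>

lemma char_poly_gram_sing_vals:
  assumes M: "M \<in> carrier_mat m n"
  shows "poly (char_poly (cadj M * M)) x = (\<Prod>i<n. x - complex_of_real ((sing_vals M ! i)\<^sup>2))"
proof -
  let ?p = "char_poly (cadj M * M)"
  have "?p = (\<Prod>z\<in>#proots ?p. [:-z, 1:])"
    using complex_poly_decompose_multiset[of ?p] degree_monic_char_poly[OF gram_carrier[OF M]] by simp
  also have "\<dots> = (\<Prod>s\<leftarrow>sing_vals M. [:- complex_of_real (s\<^sup>2), 1:])"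
    unfolding sing_vals_sq_mset[OF M, symmetric]
    by (simp add: multiset.map_comp o_def flip: prod_mset_prod_list mset_map)
  also have "\<dots> = (\<Prod>i<n. [:- complex_of_real ((sing_vals M ! i)\<^sup>2), 1:])"
    by (simp add: prod.list_conv_set_nth length_sing_vals[OF M] lessThan_atLeast0)
  finally show ?thesis
    by (simp add: poly_prod)
qed

lemma sing_val_root:
  assumes M: "M \<in> carrier_mat m n" and s: "s \<in> set (sing_vals M)"
  shows "poly (char_poly (cadj M * M)) (complex_of_real (s\<^sup>2)) = 0"
proof -
  have "complex_of_real (s\<^sup>2) \<in># image_mset (\<lambda>s. complex_of_real (s\<^sup>2)) (mset (sing_vals M))"
    using s by (auto simp del: of_real_power)
  then show ?thesis
    unfolding sing_vals_sq_mset[OF M] using char_poly_nonzero[OF gram_carrier[OF M]] by simp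
qed

text \<open>The row \<open>a\<close> in which the eigenvector has its largest modulus
  \<open>W\<close> bounds the eigenvalue by the sum of the moduli in that row. Summing over all rows
  removes the dependence on \<open>a\<close> and leaves a bound that is continuous in the
  entries.\<close>

lemma sing_val_bound:
  assumes M: "M \<in> carrier_mat m n" and s: "s \<in> set (sing_vals M)"
  shows "s\<^sup>2 \<le> (\<Sum>a<n. \<Sum>b<n. cmod ((cadj M * M) $$ (a,b)))"
proof -
  let ?N = "cadj M * M"
  obtain w where w: "\<exists>a<n. w a \<noteq> 0"
    "\<And>a. a < n \<Longrightarrow> (\<Sum>b<n. ?N $$ (a,b) * w b) = complex_of_real (s\<^sup>2) * w a"
    using eigenvalue_coords[OF gram_carrier[OF M] sing_val_root[OF M s]] by blast
  define W where "W = Max ((\<lambda>a. cmod (w a)) ` {..<n})"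
  have W: "cmod (w a) \<le> W" if "a < n" for a
    using that unfolding W_def by (intro Max_ge) auto
  have "W \<in> (\<lambda>a. cmod (w a)) ` {..<n}"
    unfolding W_def using w(1) by (intro Max_in) auto
  then obtain a where a: "a < n" "cmod (w a) = W" by auto
  have W0: "0 < W" using w(1) W by (metis less_le_trans zero_less_norm_iff)
  have "s\<^sup>2 * W = cmod (\<Sum>b<n. ?N $$ (a,b) * w b)"
    using w(2)[OF a(1)] a(2) by (simp add: norm_mult norm_power)
  also have "\<dots> \<le> (\<Sum>b<n. cmod (?N $$ (a,b)) * W)"
    by (rule sum_norm_le) (auto simp: norm_mult intro!: mult_left_mono W)
  also have "\<dots> = (\<Sum>b<n. cmod (?N $$ (a,b))) * W"
    by (simp add: sum_distrib_right)
  finally have "s\<^sup>2 \<le> (\<Sum>b<n. cmod (?N $$ (a,b)))"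
    using W0 by simp
  also have "\<dots> \<le> (\<Sum>a<n. \<Sum>b<n. cmod (?N $$ (a,b)))"
    using a(1) by (intro member_le_sum[of a "{..<n}" "\<lambda>a. \<Sum>b<n. cmod (?N $$ (a,b))"]) (auto intro: sum_nonneg)
  finally show ?thesis .
qed

section \<open>Subsequence arguments and uniqueness of sorted lists\<close>

lemma bounded_family_convergent_subseq:
  fixes f :: "nat \<Rightarrow> nat \<Rightarrow> 'a::heine_borel"
  assumes "\<And>i. i < n \<Longrightarrow> bounded (range (\<lambda>k. f k i))"
  shows "\<exists>r l. strict_mono (r :: nat \<Rightarrow> nat) \<and> (\<forall>i<n. (\<lambda>k. f (r k) i) \<longlonglongrightarrow> l i)"
  using assms
proof (induction n)
  case 0
  show ?case by (auto intro!: exI[of _ id] strict_mono_id)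
next
  case (Suc n)
  then obtain r l where r: "strict_mono r" "\<And>i. i < n \<Longrightarrow> (\<lambda>k. f (r k) i) \<longlonglongrightarrow> l i"
    by (metis less_SucI)
  have "bounded (range (\<lambda>k. f (r k) n))"
    by (rule bounded_subset[OF Suc.prems[of n]]) auto
  then obtain l' r' where r': "strict_mono r'" "((\<lambda>k. f (r k) n) \<circ> r') \<longlonglongrightarrow> l'"
    using bounded_imp_convergent_subsequence by blast
  have "(\<lambda>k. f ((r \<circ> r') k) i) \<longlonglongrightarrow> (l(n := l')) i" if "i < Suc n" for i
    using that r' LIMSEQ_subseq_LIMSEQ[OF r(2) r'(1)] by (auto simp: less_Suc_eq o_def)
  then show ?case
    using strict_mono_o[OF r(1) r'(1)] by blast
qed

text \<open>Otherwise some subsequence stays at distance at least \<open>e\<close> from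
  \<open>L\<close>, and so does each of its own subsequences.\<close>

lemma LIMSEQ_if_subseq_LIMSEQ:
  fixes X :: "nat \<Rightarrow> 'a::metric_space"
  assumes "\<And>r :: nat \<Rightarrow> nat. strict_mono r \<Longrightarrow> \<exists>r'. strict_mono r' \<and> (X \<circ> r \<circ> r') \<longlonglongrightarrow> L"
  shows "X \<longlonglongrightarrow> L"
proof (rule ccontr)
  assume "\<not> X \<longlonglongrightarrow> L"
  then obtain e where e: "0 < e" "\<not> (\<forall>\<^sub>F k in sequentially. dist (X k) L < e)"
    unfolding tendsto_iff by blast
  then obtain r :: "nat \<Rightarrow> nat" where r: "strict_mono r" "\<And>k. \<not> dist (X (r k)) L < e"
    using not_eventually_sequentiallyD[OF e(2)] by blast
  then obtain r' where r': "(X \<circ> r \<circ> r') \<longlonglongrightarrow> L"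
    using assms by blast
  then have "\<forall>\<^sub>F k in sequentially. dist ((X \<circ> r \<circ> r') k) L < e"
    using e(1) by (rule tendstoD)
  then show False
    using r(2) by (auto simp: eventually_sequentially)
qed

text \<open>Comparing characteristic polynomials identifies limits of singular values only as a
  multiset; the order recovers the individual positions.\<close>

lemma rev_sorted_list_of_mset_unique:
  assumes "sorted (rev xs)" "mset ys = mset xs" "sorted (rev ys)"
  shows "xs = (ys :: 'a::linorder list)"
  using properties_for_sort[of "rev ys" "rev xs"] assms by (metis mset_rev sorted_sort_id rev_swap)

lemma proots_prod_linear:
  "proots (\<Prod>i<n. [:- c i, 1:]) = mset (map c [0..<n])" for c :: "nat \<Rightarrow> 'a::idom"
proof (induction n)
  case (Suc n)
  have "(\<Prod>i<n. [:- c i, 1:]) \<noteq> 0" by simp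
  then have "proots ((\<Prod>i<n. [:- c i, 1:]) * [:- c n, 1:]) = mset (map c [0..<n]) + {#c n#}"
    by (subst proots_mult) (auto simp: Suc)
  then show ?case by simp
qed simp

lemma gram_index_tendsto:
  assumes M: "\<And>x. Mf x \<in> carrier_mat m n" "M0 \<in> carrier_mat m n"
    and lim: "\<And>a b. a < m \<Longrightarrow> b < n \<Longrightarrow> ((\<lambda>x. Mf x $$ (a,b)) \<longlongrightarrow> M0 $$ (a,b)) F"
    and "a < n" "b < n"
  shows "((\<lambda>x. (cadj (Mf x) * Mf x) $$ (a,b)) \<longlongrightarrow> (cadj M0 * M0) $$ (a,b)) F"
  using assms by (simp add: gram_index[where m = m and n = n]) (intro tendsto_sum tendsto_mult tendsto_cnj lim; simp)

text \<open>At a fixed \<open>z\<close> the value is det (z I - N), a polynomial in the entries of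
  N, so the coefficients never have to be examined. The sign is there because
  \<open>char_matrix N z\<close> is N - z I.\<close>

lemma char_poly_tendsto:
  fixes Nf :: "'b \<Rightarrow> 'a::real_normed_field mat"
  assumes N: "\<And>x. Nf x \<in> carrier_mat n n" "N0 \<in> carrier_mat n n"
    and lim: "\<And>a b. a < n \<Longrightarrow> b < n \<Longrightarrow> ((\<lambda>x. Nf x $$ (a,b)) \<longlongrightarrow> N0 $$ (a,b)) F"
  shows "((\<lambda>x. poly (char_poly (Nf x)) z) \<longlongrightarrow> poly (char_poly N0) z) F"
  unfolding char_poly_matrix[OF N(1)] char_poly_matrix[OF N(2)]
proof (rule tendsto_det[where n = n])
  fix i j assume ij: "i < n" "j < n"
  show "((\<lambda>x. (- char_matrix (Nf x) z) $$ (i,j)) \<longlongrightarrow> (- char_matrix N0 z) $$ (i,j)) F"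
    using ij N carrier_matD[OF N(1)] carrier_matD[OF N(2)]
    by (auto simp: char_matrix_def intro!: tendsto_intros lim)
qed (use N in auto)

lemma sing_vals_tendsto_sequentially:
  assumes M: "\<And>k. Mk k \<in> carrier_mat m n" "M0 \<in> carrier_mat m n"
    and lim: "\<And>a b. a < m \<Longrightarrow> b < n \<Longrightarrow> (\<lambda>k. Mk k $$ (a,b)) \<longlonglongrightarrow> M0 $$ (a,b)"
    and i: "i < n"
  shows "(\<lambda>k. sing_vals (Mk k) ! i) \<longlonglongrightarrow> sing_vals M0 ! i"
proof -
  have N: "cadj (Mk k) * Mk k \<in> carrier_mat n n" "cadj M0 * M0 \<in> carrier_mat n n" for k
    using M gram_carrier by blast+
  have gram_lim: "(\<lambda>k. (cadj (Mk k) * Mk k) $$ (a,b)) \<longlonglongrightarrow> (cadj M0 * M0) $$ (a,b)"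
    if "a < n" "b < n" for a b
    by (rule gram_index_tendsto[OF M lim that])
  \<comment> \<open>The sums \<open>B k\<close> converge with the entries of the Gram matrices, so
    they are bounded in \<open>k\<close>, and with them all singular values.\<close>
  define B where "B k = (\<Sum>a<n. \<Sum>b<n. cmod ((cadj (Mk k) * Mk k) $$ (a,b)))" for k
  have "B \<longlonglongrightarrow> (\<Sum>a<n. \<Sum>b<n. cmod ((cadj M0 * M0) $$ (a,b)))"
    unfolding B_def by (intro tendsto_sum tendsto_norm gram_lim) auto
  then obtain C where C: "\<And>k. norm (B k) \<le> C"
    using Bseq_def convergent_imp_Bseq convergentI by metis
  have in_set: "sing_vals (Mk k) ! i \<in> set (sing_vals (Mk k))" if "i < n" for i k
    using that length_sing_vals[OF M(1)] by simp
  have bd: "bounded (range (\<lambda>k. sing_vals (Mk k) ! i))" if "i < n" for i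
  proof (rule boundedI)
    fix s assume "s \<in> range (\<lambda>k. sing_vals (Mk k) ! i)"
    then obtain k where k: "s = sing_vals (Mk k) ! i" by auto
    have "s\<^sup>2 \<le> B k" "0 \<le> s"
      using sing_val_bound[OF M(1) in_set[OF that]] sing_vals_nonneg[OF M(1) in_set[OF that]]
      by (auto simp: k B_def)
    then show "norm s \<le> sqrt C" using C[of k] by (simp add: real_le_rsqrt)
  qed
  show ?thesis
  proof (rule LIMSEQ_if_subseq_LIMSEQ)
    fix r :: "nat \<Rightarrow> nat" assume r: "strict_mono r"
    have "bounded (range (\<lambda>k. sing_vals (Mk (r k)) ! i))" if "i < n" for i
      by (rule bounded_subset[OF bd[OF that]]) auto
    then obtain r' l where r': "strict_mono r'"
      and l: "\<And>i. i < n \<Longrightarrow> (\<lambda>k. sing_vals (Mk (r (r' k))) ! i) \<longlonglongrightarrow> l i"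
      using bounded_family_convergent_subseq[of n "\<lambda>k i. sing_vals (Mk (r k)) ! i"] by blast
    have rr: "strict_mono (r \<circ> r')" using r r' by (rule strict_mono_o)
    \<comment> \<open>The values at \<open>z\<close> along the subsequence have two limits: the
      limiting characteristic polynomial, by continuity in the entries, and the product over the
      limits \<open>l i\<close> of the singular values.\<close>
    have "poly (char_poly (cadj M0 * M0)) z = (\<Prod>i<n. z - complex_of_real ((l i)\<^sup>2))" for z
    proof (rule LIMSEQ_unique)
      show "(\<lambda>k. poly (char_poly (cadj (Mk ((r \<circ> r') k)) * Mk ((r \<circ> r') k))) z)
          \<longlonglongrightarrow> poly (char_poly (cadj M0 * M0)) z"
        using LIMSEQ_subseq_LIMSEQ[OF char_poly_tendsto[OF N gram_lim] rr] by (simp add: o_def)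
      show "(\<lambda>k. poly (char_poly (cadj (Mk ((r \<circ> r') k)) * Mk ((r \<circ> r') k))) z)
          \<longlonglongrightarrow> (\<Prod>i<n. z - complex_of_real ((l i)\<^sup>2))"
        unfolding char_poly_gram_sing_vals[OF M(1)] o_def
        by (intro tendsto_intros l) auto
    qed
    then have p: "char_poly (cadj M0 * M0) = (\<Prod>i<n. [:- complex_of_real ((l i)\<^sup>2), 1:])"
      by (subst poly_eq_poly_eq_iff[symmetric]) (auto simp: fun_eq_iff poly_prod)
    \<comment> \<open>Nonnegativity makes \<open>l i\<close> recoverable from its square, which is
      all that the polynomial determines.\<close>
    have l0: "0 \<le> l i" if "i < n" for i
      using l[OF that] sing_vals_nonneg[OF M(1) in_set[OF that]] by (intro LIMSEQ_le_const) auto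
    have "mset (sing_vals M0) = mset (map (\<lambda>i. sqrt (Re (complex_of_real ((l i)\<^sup>2)))) [0..<n])"
      unfolding sing_vals_mset p proots_prod_linear by (simp add: multiset.map_comp o_def)
    also have "map (\<lambda>i. sqrt (Re (complex_of_real ((l i)\<^sup>2)))) [0..<n] = map l [0..<n]"
      using l0 by simp
    finally have ms: "mset (sing_vals M0) = mset (map l [0..<n])" .
    \<comment> \<open>The decreasing order survives the limit, so \<open>l\<close> lists the
      singular values of \<open>M0\<close> in their own order.\<close>
    have "l b \<le> l a" if "a \<le> b" "b < n" for a b
    proof -
      have "a < n" using that by simp
      have "sing_vals (Mk (r (r' k))) ! b \<le> sing_vals (Mk (r (r' k))) ! a" for k
        using sorted_rev_sing_vals[of "Mk (r (r' k))"] that length_sing_vals[OF M(1)]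
        by (auto simp: sorted_rev_iff_nth_mono)
      then show ?thesis
        using l[OF \<open>b < n\<close>] l[OF \<open>a < n\<close>] by (intro LIMSEQ_le) auto
    qed
    then have "sorted (rev (map l [0..<n]))"
      by (subst sorted_rev_iff_nth_mono) auto
    then have "sing_vals M0 = map l [0..<n]"
      using rev_sorted_list_of_mset_unique ms sorted_rev_sing_vals by metis
    then have "(\<lambda>k. sing_vals (Mk ((r \<circ> r') k)) ! i) \<longlonglongrightarrow> sing_vals M0 ! i"
      using l[OF i] i by simp
    then show "\<exists>r'. strict_mono r' \<and> ((\<lambda>k. sing_vals (Mk k) ! i) \<circ> r \<circ> r') \<longlonglongrightarrow> sing_vals M0 ! i"
      using r' by (auto simp: o_def)
  qed
qed

section \<open>Derivative of a simple singular value\<close>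

text \<open>A product rule in which \<open>c\<close> needs only a limit at \<open>x\<close>. Since g
  x = 0, the difference between c y * g y and c0 * g' (y - x) is c y times the remainder of
  \<open>g\<close> plus (c y - c0) * g' (y - x), and the last term is o(|y - x|) because g' is
  bounded.\<close>

lemma has_derivative_mult_vanishing:
  fixes g c :: "'a::real_normed_vector \<Rightarrow> 'b::real_normed_algebra"
  assumes g: "(g has_derivative g') (at x)" "g x = 0" and c: "(c \<longlongrightarrow> c0) (at x)"
  shows "((\<lambda>y. c y * g y) has_derivative (\<lambda>h. c0 * g' h)) (at x)"
proof -
  interpret g': bounded_linear g' by (rule has_derivative_bounded_linear[OF g(1)])
  obtain K where K: "\<And>h. norm (g' h) \<le> norm h * K"
    using g'.bounded by blast
  let ?q = "\<lambda>y z. (1 / norm (y - x)) *\<^sub>R z"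
  have "Zfun (\<lambda>y. c y - c0) (at x)"
    using c by (simp add: tendsto_Zfun_iff)
  moreover have "Bfun (\<lambda>y. ?q y (g' (y - x))) (at x)"
  proof (rule BfunI)
    have "norm (?q y (g' (y - x))) \<le> K" if "y \<noteq> x" for y
      using K[of "y - x"] that by (simp add: divide_le_eq mult.commute)
    then show "\<forall>\<^sub>F y in at x. norm (?q y (g' (y - x))) \<le> K"
      by (simp add: eventually_at_filter)
  qed
  ultimately have "((\<lambda>y. (c y - c0) * ?q y (g' (y - x))) \<longlongrightarrow> 0) (at x)"
    using bounded_bilinear.Zfun_prod_Bfun[OF bounded_bilinear_mult]
    by (simp add: tendsto_Zfun_iff del: mult_scaleR_right)
  moreover have "((\<lambda>y. c y * ?q y (g y - g x - g' (y - x))) \<longlongrightarrow> c0 * 0) (at x)"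
    using g(1) by (intro tendsto_mult c) (simp add: has_derivative_at_within inverse_eq_divide)
  ultimately have "((\<lambda>y. c y * ?q y (g y - g x - g' (y - x)) + (c y - c0) * ?q y (g' (y - x))) \<longlongrightarrow> 0) (at x)"
    using tendsto_add by fastforce
  then have "((\<lambda>y. ?q y (c y * g y - c x * g x - c0 * g' (y - x))) \<longlongrightarrow> 0) (at x)"
    by (simp add: g(2) algebra_simps)
  moreover have "bounded_linear (\<lambda>h. c0 * g' h)"
    by (rule bounded_linear_const_mult[OF g'.bounded_linear])
  ultimately show ?thesis
    by (simp add: has_derivative_at_within inverse_eq_divide)
qed

text \<open>Enumerates the naturals other than \<open>i\<close> in increasing order: the original
  index of row or column \<open>b\<close> once \<open>i\<close> has been deleted.\<close>

definition skip :: "nat \<Rightarrow> nat \<Rightarrow> nat" where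
  "skip i b = (if b < i then b else Suc b)"

lemma bij_betw_skip: "i < n \<Longrightarrow> bij_betw (skip i) {..<n - 1} ({..<n} - {i})"
  by (rule bij_betwI[of _ _ _ "\<lambda>b. if b < i then b else b - 1"])
    (auto simp: skip_def split: if_splits)

lemma mat_delete_skip:
  "a < dim_row K - 1 \<Longrightarrow> b < dim_col K - 1 \<Longrightarrow> mat_delete K i j $$ (a,b) = K $$ (skip i a, skip j b)"
  by (simp add: mat_delete_def skip_def)

text \<open>With w i = 0, column \<open>i\<close> contributes nothing to the equations; dropping
  equation \<open>i\<close> as well leaves a homogeneous system with invertible matrix. A kernel
  vector is therefore determined by its coordinate \<open>i\<close>.\<close>

lemma kernel_vanishes_if_minor_nonzero:
  fixes K :: "'a::field mat"
  assumes K: "K \<in> carrier_mat n n" and i: "i < n"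
    and det: "Determinant.det (mat_delete K i i) \<noteq> 0"
    and ker: "\<And>a. a < n \<Longrightarrow> (\<Sum>b<n. K $$ (a,b) * w b) = 0" and wi: "w i = 0" and b: "b < n"
  shows "w b = 0"
proof (rule ccontr)
  assume nz: "w b \<noteq> 0"
  define x where "x = vec (n - 1) (\<lambda>b. w (skip i b))"
  have D: "mat_delete K i i \<in> carrier_mat (n - 1) (n - 1)"
    by (rule mat_delete_carrier[OF K])
  have "b \<in> skip i ` {..<n - 1}"
    using bij_betw_imp_surj_on[OF bij_betw_skip[OF i]] b nz wi by auto
  then obtain b' where b': "b' < n - 1" "skip i b' = b" by auto
  have "x $ b' \<noteq> 0"
    using b' nz by (simp add: x_def)
  then have "x \<noteq> 0\<^sub>v (n - 1)"
    using b' by auto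
  moreover have "mat_delete K i i *\<^sub>v x = 0\<^sub>v (n - 1)"
  proof (rule eq_vecI)
    fix a assume "a < dim_vec (0\<^sub>v (n - 1) :: 'a Matrix.vec)"
    then have a: "a < n - 1" by simp
    then have sa: "skip i a < n" by (auto simp: skip_def)
    have "(mat_delete K i i *\<^sub>v x) $ a = (\<Sum>b<n - 1. K $$ (skip i a, skip i b) * w (skip i b))"
      using a D K by (auto simp: scalar_prod_def x_def mat_delete_skip lessThan_atLeast0 intro!: sum.cong)
    also have "\<dots> = (\<Sum>b\<in>{..<n} - {i}. K $$ (skip i a, b) * w b)"
      by (rule sum.reindex_bij_betw[OF bij_betw_skip[OF i]])
    also have "\<dots> = (\<Sum>b<n. K $$ (skip i a, b) * w b)"
      using i wi by (subst (2) sum.remove[of _ i]) auto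
    also have "\<dots> = 0"
      by (rule ker[OF sa])
    finally show "(mat_delete K i i *\<^sub>v x) $ a = 0\<^sub>v (n - 1) $ a"
      using a by simp
  qed (use carrier_matD[OF D] in simp)
  moreover have "x \<in> carrier_vec (n - 1)" by (simp add: x_def)
  ultimately show False
    using det det_0_iff_vec_prod_zero_field[OF D] by blast
qed

lemma simple_root_minor_nonzero:
  fixes N :: "'a::field_char_0 mat"
  assumes N: "N \<in> carrier_mat n n" and ord: "order z (char_poly N) = 1"
  obtains i where "i < n" "Determinant.det (mat_delete (- char_matrix N z) i i) \<noteq> 0"
proof -
  have "char_poly N \<noteq> 0" by (rule char_poly_nonzero[OF N])
  \<comment> \<open>A root of order 1 forces positive degree, so in characteristic 0 the derivative
    is a nonzero polynomial.\<close>
  then have "pderiv (char_poly N) \<noteq> 0"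
    using ord by (metis order_0I order_root pderiv_eq_0_iff degree_0 gr0I order_degree le_zero_eq zero_neq_one)
  then have "order z (pderiv (char_poly N)) = 0"
    using order_pderiv[of "char_poly N" z] ord \<open>char_poly N \<noteq> 0\<close> order_root[of "char_poly N" z] by simp
  then have "poly (pderiv (char_poly N)) z \<noteq> 0"
    using \<open>pderiv (char_poly N) \<noteq> 0\<close> by (simp add: order_root)
  then have "(\<Sum>i<n. poly (char_poly (mat_delete N i i)) z) \<noteq> 0"
    unfolding pderiv_char_poly[OF N] by (simp add: poly_sum)
  then obtain i where i: "i < n" "poly (char_poly (mat_delete N i i)) z \<noteq> 0"
    by (elim sum.not_neutral_contains_not_neutral) auto
  have "- char_matrix (mat_delete N i i) z = mat_delete (- char_matrix N z) i i"
    using N i(1) by (intro eq_matI) (auto simp: mat_delete_def char_matrix_def)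
  then show thesis
    using i that char_poly_matrix[OF mat_delete_carrier[OF N], of i i z] by simp
qed

lemma cofactor_tendsto:
  fixes A :: "'b \<Rightarrow> 'a::{comm_ring_1,real_normed_algebra_1} mat"
  assumes A: "\<And>x. A x \<in> carrier_mat n n" "A0 \<in> carrier_mat n n"
    and lim: "\<And>i j. i < n \<Longrightarrow> j < n \<Longrightarrow> ((\<lambda>x. A x $$ (i,j)) \<longlongrightarrow> A0 $$ (i,j)) F"
  shows "((\<lambda>x. cofactor (A x) i j) \<longlongrightarrow> cofactor A0 i j) F"
  unfolding cofactor_def
proof (intro tendsto_mult tendsto_const tendsto_det[where n = "n - 1"] mat_delete_carrier A)
  fix a b assume "a < n - 1" "b < n - 1"
  then show "((\<lambda>x. mat_delete (A x) i j $$ (a,b)) \<longlongrightarrow> mat_delete A0 i j $$ (a,b)) F"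
    using carrier_matD[OF A(1)] carrier_matD[OF A(2)]
    by (simp add: mat_delete_skip) (rule lim; auto simp: skip_def)
qed

text \<open>Entry (a,i) of K adj K = (det K) I. For a = i it is the expansion of det K along row
  \<open>i\<close>; otherwise it is the expansion of a determinant in which row \<open>a\<close>
  occurs twice.\<close>

lemma cofactor_kernel:
  fixes K :: "'a::comm_ring_1 mat"
  assumes K: "K \<in> carrier_mat n n" and "Determinant.det K = 0" "a < n" "i < n"
  shows "(\<Sum>b<n. K $$ (a,b) * cofactor K i b) = 0"
proof -
  have "(K * adj_mat K) $$ (a,i) = 0"
    using assms by (simp add: adj_mat(2)[OF K])
  then show ?thesis
    using K assms index_mult_sum[OF K adj_mat(1)[OF K], of a i] by (simp add: adj_mat_def)
qed

text \<open>The first-order perturbation formula lam' = v^H N' v / v^H v. \<open>lam\<close> may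
  pick any root at each \<open>y\<close>; its continuity at \<open>x\<close> ties the choice to the
  simple eigenvalue lam x.\<close>

lemma eigenvalue_has_derivative:
  fixes Nf :: "'a::real_normed_vector \<Rightarrow> complex mat" and lam :: "'a \<Rightarrow> complex"
  assumes N: "\<And>y. Nf y \<in> carrier_mat n n"
    and N': "\<And>a b. a < n \<Longrightarrow> b < n \<Longrightarrow> ((\<lambda>y. Nf y $$ (a,b)) has_derivative N' a b) (at x)"
    and herm: "\<And>a b. a < n \<Longrightarrow> b < n \<Longrightarrow> Nf x $$ (b,a) = cnj (Nf x $$ (a,b))"
    and root: "\<And>y. poly (char_poly (Nf y)) (lam y) = 0"
    and cont: "(lam \<longlongrightarrow> lam x) (at x)" and real: "cnj (lam x) = lam x"
    and simple: "order (lam x) (char_poly (Nf x)) = 1"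
    and v0: "\<exists>a<n. v a \<noteq> 0"
    and v: "\<And>a. a < n \<Longrightarrow> (\<Sum>b<n. Nf x $$ (a,b) * v b) = lam x * v a"
  shows "(lam has_derivative (\<lambda>h. (\<Sum>a<n. \<Sum>b<n. cnj (v a) * N' a b h * v b) /
    (\<Sum>a<n. complex_of_real ((cmod (v a))\<^sup>2)))) (at x)"
proof -
  \<comment> \<open>\<open>K y\<close> is lam y I - N y, which is singular for every
    \<open>y\<close>.\<close>
  define K where "K y = - char_matrix (Nf y) (lam y)" for y
  have K: "K y \<in> carrier_mat n n" for y
    using N[of y] by (simp add: K_def)
  have K_index: "K y $$ (a,b) = (if a = b then lam y else 0) - Nf y $$ (a,b)" if "a < n" "b < n" for y a b
    using N[of y] that by (auto simp: K_def char_matrix_def)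
  have N_lim: "((\<lambda>y. Nf y $$ (a,b)) \<longlongrightarrow> Nf x $$ (a,b)) (at x)" if "a < n" "b < n" for a b
    using has_derivative_continuous[OF N'[OF that]] by (simp add: continuous_within)
  have K_lim: "((\<lambda>y. K y $$ (a,b)) \<longlongrightarrow> K x $$ (a,b)) (at x)" if "a < n" "b < n" for a b
    using that by (auto simp: K_index intro!: tendsto_intros cont N_lim)
  have K_row: "(\<Sum>b<n. K y $$ (a,b) * w b) = lam y * w a - (\<Sum>b<n. Nf y $$ (a,b) * w b)"
    if "a < n" for y a and w :: "nat \<Rightarrow> complex"
    using that by (simp add: K_index left_diff_distrib sum_subtractf if_distrib[of "\<lambda>t. t * _"] cong: if_cong)
  \<comment> \<open>The index is chosen at \<open>x\<close> alone; the same row of cofactors is then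
    used at every \<open>y\<close>.\<close>
  obtain i where i: "i < n" "Determinant.det (mat_delete (K x) i i) \<noteq> 0"
    using simple_root_minor_nonzero[OF N simple] unfolding K_def by blast
  define w where "w y b = cofactor (K y) i b" for y b
  have w_lim: "((\<lambda>y. w y b) \<longlongrightarrow> w x b) (at x)" for b
    unfolding w_def by (rule cofactor_tendsto[OF K K K_lim])
  have w: "(\<Sum>b<n. Nf y $$ (a,b) * w y b) = lam y * w y a" if "a < n" for y a
  proof -
    have "Determinant.det (K y) = 0"
      using root[of y] by (simp add: K_def char_poly_matrix[OF N])
    then show ?thesis
      using cofactor_kernel[OF K _ that i(1), of y] K_row[OF that, of y "w y"] by (simp add: w_def)
  qed
  note vanish = kernel_vanishes_if_minor_nonzero[OF K i]
  \<comment> \<open>If v i were 0, the nonzero minor would force all of \<open>v\<close> to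
    vanish.\<close>
  have vi: "v i \<noteq> 0"
    using vanish[of v] v v0 by (auto simp: K_row)
  define c where "c = w x i / v i"
  \<comment> \<open>w x i is the cofactor at (i,i), that is, the nonzero principal minor itself, as
    its sign exponent is even.\<close>
  have c0: "c \<noteq> 0"
    using i vi by (simp add: c_def w_def cofactor_def)
  have wc: "w x b = c * v b" if "b < n" for b
  proof -
    \<comment> \<open>Both vectors lie in the kernel of \<open>K x\<close>, and \<open>c\<close> is
      chosen so that their difference vanishes at coordinate \<open>i\<close>.\<close>
    have "w x b - c * v b = 0"
    proof (rule vanish[of "\<lambda>b. w x b - c * v b"])
      fix a assume a: "a < n"
      have "(\<Sum>b<n. Nf x $$ (a,b) * (w x b - c * v b))
          = (\<Sum>b<n. Nf x $$ (a,b) * w x b) - c * (\<Sum>b<n. Nf x $$ (a,b) * v b)"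
        by (simp add: sum_subtractf sum_distrib_left algebra_simps)
      then have "(\<Sum>b<n. Nf x $$ (a,b) * (w x b - c * v b)) = lam x * (w x a - c * v a)"
        using a by (simp add: w v right_diff_distrib)
      then show "(\<Sum>b<n. K x $$ (a,b) * (w x b - c * v b)) = 0"
        using K_row[OF a, of x "\<lambda>b. w x b - c * v b"] by simp
    qed (use vi that in \<open>simp_all add: c_def\<close>)
    then show ?thesis by simp
  qed
  define V where "V = (\<Sum>a<n. complex_of_real ((cmod (v a))\<^sup>2))"
  have V: "V = (\<Sum>a<n. cnj (v a) * v a)"
    unfolding V_def by (intro sum.cong refl) (simp only: complex_norm_square mult.commute)
  have "0 < (\<Sum>a<n. (cmod (v a))\<^sup>2)"
    using v0 by (auto intro!: sum_pos2)
  then have V0: "V \<noteq> 0"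
    unfolding V_def of_real_sum[symmetric] by (simp del: of_real_sum)
  define S where "S y = (\<Sum>a<n. cnj (v a) * w y a)" for y
  have Sx: "S x = c * V"
    by (simp add: S_def V wc sum_distrib_left mult_ac)
  have S_lim: "(S \<longlongrightarrow> S x) (at x)"
    unfolding S_def by (intro tendsto_intros w_lim)
  \<comment> \<open>v^H is a left eigenvector of N x, because N x is Hermitian and lam x is
    real.\<close>
  have left: "(\<Sum>a<n. \<Sum>b<n. cnj (v a) * Nf x $$ (a,b) * w y b) = lam x * S y" for y
  proof -
    have "(\<Sum>a<n. \<Sum>b<n. cnj (v a) * Nf x $$ (a,b) * w y b)
        = (\<Sum>b<n. \<Sum>a<n. cnj (v a) * Nf x $$ (a,b) * w y b)"
      by (rule sum.swap)
    also have "\<dots> = (\<Sum>b<n. cnj (\<Sum>a<n. Nf x $$ (b,a) * v a) * w y b)"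
    proof (rule sum.cong[OF refl])
      fix b assume b: "b \<in> {..<n}"
      have "cnj (v a) * Nf x $$ (a,b) = cnj (Nf x $$ (b,a) * v a)" if "a < n" for a
        using herm[of a b] b that by simp
      then show "(\<Sum>a<n. cnj (v a) * Nf x $$ (a,b) * w y b) = cnj (\<Sum>a<n. Nf x $$ (b,a) * v a) * w y b"
        unfolding cnj_sum sum_distrib_right by (intro sum.cong refl) auto
    qed
    also have "\<dots> = lam x * S y"
      using v real by (simp add: S_def sum_distrib_left mult_ac del: cnj_sum)
    finally show ?thesis .
  qed
  have diff: "(lam y - lam x) * S y = (\<Sum>a<n. \<Sum>b<n. cnj (v a) * (Nf y $$ (a,b) - Nf x $$ (a,b)) * w y b)" for y
  proof -
    have "(\<Sum>a<n. \<Sum>b<n. cnj (v a) * Nf y $$ (a,b) * w y b)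
        = (\<Sum>a<n. cnj (v a) * (\<Sum>b<n. Nf y $$ (a,b) * w y b))"
      by (simp add: sum_distrib_left mult.assoc)
    also have "\<dots> = (\<Sum>a<n. cnj (v a) * (lam y * w y a))"
      by (simp add: w)
    also have "\<dots> = lam y * S y"
      by (simp add: S_def sum_distrib_left mult_ac)
    finally show ?thesis
      using left[of y] by (simp add: algebra_simps sum_subtractf)
  qed
  \<comment> \<open>The preceding identity solved for lam y. It agrees with \<open>lam\<close>
    wherever S y is nonzero, and at \<open>x\<close> because the increments vanish there; so a limit
    of its coefficients is enough to differentiate it.\<close>
  define f where "f y = lam x + (\<Sum>a<n. \<Sum>b<n. (cnj (v a) * w y b / S y) * (Nf y $$ (a,b) - Nf x $$ (a,b)))" for y
  have "eventually (\<lambda>y. S y \<noteq> 0) (at x)"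
    using S_lim Sx c0 V0 by (intro tendsto_imp_eventually_ne[of S "S x"]) auto
  then have ev: "eventually (\<lambda>y. f y = lam y) (at x)"
  proof (rule eventually_mono)
    fix y assume S0: "S y \<noteq> 0"
    have "f y = lam x + (\<Sum>a<n. \<Sum>b<n. cnj (v a) * (Nf y $$ (a,b) - Nf x $$ (a,b)) * w y b) / S y"
      unfolding f_def sum_divide_distrib by (simp add: mult_ac)
    also have "\<dots> = lam y"
      using S0 by (simp add: diff[symmetric])
    finally show "f y = lam y" .
  qed
  have "(f has_derivative (\<lambda>h. 0 + (\<Sum>a<n. \<Sum>b<n. (cnj (v a) * w x b / S x) * N' a b h))) (at x)"
    unfolding f_def
  proof (intro has_derivative_add has_derivative_const has_derivative_sum has_derivative_mult_vanishing)
    fix a b assume "a \<in> {..<n}" "b \<in> {..<n}"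
    then show "((\<lambda>y. Nf y $$ (a,b) - Nf x $$ (a,b)) has_derivative N' a b) (at x)"
      using has_derivative_diff[OF N' has_derivative_const, of a b] by simp
    show "((\<lambda>y. cnj (v a) * w y b / S y) \<longlongrightarrow> cnj (v a) * w x b / S x) (at x)"
      using Sx c0 V0 by (intro tendsto_intros w_lim S_lim) auto
  qed simp
  moreover have "0 + (\<Sum>a<n. \<Sum>b<n. (cnj (v a) * w x b / S x) * N' a b h)
      = (\<Sum>a<n. \<Sum>b<n. cnj (v a) * N' a b h * v b) / V" for h
    using c0 V0 unfolding Sx by (simp add: wc sum_divide_distrib field_simps)
  ultimately have "(f has_derivative (\<lambda>h. (\<Sum>a<n. \<Sum>b<n. cnj (v a) * N' a b h * v b) / V)) (at x)"
    by simp
  then show ?thesis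
    unfolding V_def[symmetric]
    by (rule has_derivative_transform_eventually[OF _ ev]) (simp_all add: f_def)
qed


section \<open>Ordered singular values near a simple one, and their derivative\<close>

lemma sing_vals_tendsto:
  fixes Mf :: "'a::first_countable_topology \<Rightarrow> complex mat"
  assumes M: "\<And>y. Mf y \<in> carrier_mat m n"
    and lim: "\<And>a b. a < m \<Longrightarrow> b < n \<Longrightarrow> ((\<lambda>y. Mf y $$ (a,b)) \<longlongrightarrow> Mf x $$ (a,b)) (at x)"
    and i: "i < n"
  shows "((\<lambda>y. sing_vals (Mf y) ! i) \<longlongrightarrow> sing_vals (Mf x) ! i) (at x)"
  unfolding tendsto_at_iff_sequentially
proof (intro allI impI)
  fix X :: "nat \<Rightarrow> 'a" assume X: "\<forall>k. X k \<in> UNIV - {x}" "X \<longlonglongrightarrow> x"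
  have "(\<lambda>k. Mf (X k) $$ (a,b)) \<longlonglongrightarrow> Mf x $$ (a,b)" if "a < m" "b < n" for a b
    using lim[OF that] X unfolding tendsto_at_iff_sequentially by (auto simp: o_def)
  then show "((\<lambda>y. sing_vals (Mf y) ! i) \<circ> X) \<longlonglongrightarrow> sing_vals (Mf x) ! i"
    using sing_vals_tendsto_sequentially[of "\<lambda>k. Mf (X k)" m n "Mf x" i] M i by (simp add: o_def)
qed

text \<open>Turns simplicity into finitely many inequations between positions of the list; as
  positions vary continuously, each of them persists under small perturbations.\<close>

lemma count_mset_nth_eq_1_iff:
  assumes "k < length xs"
  shows "count (mset xs) (xs ! k) = 1 \<longleftrightarrow> (\<forall>i<length xs. i \<noteq> k \<longrightarrow> xs ! i \<noteq> xs ! k)"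
proof -
  let ?S = "{i. i < length xs \<and> xs ! i = xs ! k}"
  have "count (mset xs) (xs ! k) = card ?S"
    by (simp add: count_mset count_list_eq_length_filter length_filter_conv_card) (metis (lifting))
  moreover have "card ?S = 1 \<longleftrightarrow> ?S = {k}"
  proof
    assume "card ?S = 1"
    then obtain z where z: "?S = {z}" by (rule card_1_singletonE)
    moreover have "k \<in> ?S" using assms by simp
    ultimately show "?S = {k}" by simp
  qed simp
  moreover have "?S = {k} \<longleftrightarrow> (\<forall>i<length xs. i \<noteq> k \<longrightarrow> xs ! i \<noteq> xs ! k)"
    using assms by blast
  ultimately show ?thesis by simp
qed

text \<open>Squaring is injective on nonnegative reals, so no two singular values merge into one
  eigenvalue and the multiplicity carries over.\<close>

lemma order_gram_sing_val:
  assumes M: "M \<in> carrier_mat m n" and s: "count (mset (sing_vals M)) s = 1"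
  shows "order (complex_of_real (s\<^sup>2)) (char_poly (cadj M * M)) = 1"
proof -
  let ?f = "\<lambda>s. complex_of_real (s\<^sup>2)"
  have "s \<in># mset (sing_vals M)" using s by (metis count_eq_zero_iff zero_neq_one)
  then have sM: "s \<in> set (sing_vals M)" by simp
  have "t = s" if "t \<in> set (sing_vals M)" "?f t = ?f s" for t
    using sing_vals_nonneg[OF M that(1)] sing_vals_nonneg[OF M sM] that(2)
    by (metis of_real_eq_iff power2_eq_iff_nonneg)
  then have "?f -` {?f s} \<inter> set (sing_vals M) = {s}"
    using sM by auto
  then have "count (image_mset ?f (mset (sing_vals M))) (?f s) = 1"
    using s by (simp add: count_image_mset del: of_real_power)
  then show ?thesis
    using char_poly_nonzero[OF gram_carrier[OF M]] by (simp add: sing_vals_sq_mset[OF M] del: of_real_power)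
qed

text \<open>The derivative of sigma^2 is 2 Re ((M v)^H M' v) / ||v||^2, and the square root divides
  it by 2 sigma. The eigenvector \<open>v\<close> may have any length, and M v stands in for sigma
  u, so the formula makes sense without a left singular vector.\<close>

lemma sing_val_has_derivative:
  fixes Mf :: "'a::real_normed_vector \<Rightarrow> complex mat" and v :: "nat \<Rightarrow> complex"
  assumes M: "\<And>y. Mf y \<in> carrier_mat m n"
    and M': "\<And>c b. c < m \<Longrightarrow> b < n \<Longrightarrow> ((\<lambda>y. Mf y $$ (c,b)) has_derivative M' c b) (at x)"
    and k: "k < n" and nz: "sing_vals (Mf x) ! k \<noteq> 0"
    and simple: "count (mset (sing_vals (Mf x))) (sing_vals (Mf x) ! k) = 1"
    and v0: "\<exists>a<n. v a \<noteq> 0"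
    and v: "\<And>a. a < n \<Longrightarrow> (\<Sum>b<n. (cadj (Mf x) * Mf x) $$ (a,b) * v b)
      = complex_of_real ((sing_vals (Mf x) ! k)\<^sup>2) * v a"
  shows "((\<lambda>y. sing_vals (Mf y) ! k) has_derivative
    (\<lambda>h. Re (\<Sum>c<m. \<Sum>b<n. cnj (\<Sum>a<n. Mf x $$ (c,a) * v a) * M' c b h * v b)
      / (sing_vals (Mf x) ! k * (\<Sum>a<n. (cmod (v a))\<^sup>2)))) (at x)"
proof -
  define s where "s y = sing_vals (Mf y) ! k" for y
  define V where "V = (\<Sum>a<n. (cmod (v a))\<^sup>2)"
  define z where "z c = (\<Sum>a<n. Mf x $$ (c,a) * v a)" for c
  define P where "P h = (\<Sum>c<m. \<Sum>b<n. cnj (z c) * M' c b h * v b)" for h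
  have s_set: "s y \<in> set (sing_vals (Mf y))" for y
    using k length_sing_vals[OF M] by (simp add: s_def)
  have s0: "0 \<le> s y" for y
    by (rule sing_vals_nonneg[OF M s_set])
  have V0: "0 < V"
    using v0 unfolding V_def by (auto intro!: sum_pos2)
  have M_lim: "((\<lambda>y. Mf y $$ (c,b)) \<longlongrightarrow> Mf x $$ (c,b)) (at x)" if "c < m" "b < n" for c b
    using has_derivative_continuous[OF M'[OF that]] by (simp add: continuous_within)
  have s_lim: "(s \<longlongrightarrow> s x) (at x)"
    unfolding s_def using M M_lim k by (rule sing_vals_tendsto)
  have "((\<lambda>y. complex_of_real ((s y)\<^sup>2)) has_derivative
      (\<lambda>h. (\<Sum>a<n. \<Sum>b<n. cnj (v a) * (\<Sum>c<m. cnj (M' c a h) * Mf x $$ (c,b) + cnj (Mf x $$ (c,a)) * M' c b h) * v b)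
        / (\<Sum>a<n. complex_of_real ((cmod (v a))\<^sup>2)))) (at x)"
  proof (rule eigenvalue_has_derivative[where Nf = "\<lambda>y. cadj (Mf y) * Mf y"])
    fix a b assume ab: "a < n" "b < n"
    show "((\<lambda>y. (cadj (Mf y) * Mf y) $$ (a,b)) has_derivative
        (\<lambda>h. \<Sum>c<m. cnj (M' c a h) * Mf x $$ (c,b) + cnj (Mf x $$ (c,a)) * M' c b h)) (at x)"
      unfolding gram_index[OF M ab] using ab
      by (auto intro!: derivative_eq_intros has_derivative_sum M')
    show "(cadj (Mf x) * Mf x) $$ (b,a) = cnj ((cadj (Mf x) * Mf x) $$ (a,b))"
      unfolding gram_index[OF M ab] gram_index[OF M ab(2,1)] by (simp add: mult.commute)
  next
    show "((\<lambda>y. complex_of_real ((s y)\<^sup>2)) \<longlongrightarrow> complex_of_real ((s x)\<^sup>2)) (at x)"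
      by (intro tendsto_intros s_lim)
  qed (use M gram_carrier sing_val_root[OF M s_set] order_gram_sing_val[OF M simple] v v0
      in \<open>auto simp: s_def\<close>)
  \<comment> \<open>The two halves of the product rule for M^H M contribute complex conjugates,
    together twice the real part of \<open>P h\<close>.\<close>
  moreover have "(\<Sum>a<n. \<Sum>b<n. cnj (v a) * (\<Sum>c<m. cnj (M' c a h) * Mf x $$ (c,b) + cnj (Mf x $$ (c,a)) * M' c b h) * v b)
      = complex_of_real (2 * Re (P h))" for h
  proof -
    have "(\<Sum>a<n. \<Sum>b<n. cnj (v a) * (\<Sum>c<m. cnj (M' c a h) * Mf x $$ (c,b) + cnj (Mf x $$ (c,a)) * M' c b h) * v b)
        = (\<Sum>a<n. \<Sum>b<n. \<Sum>c<m. cnj (v a * M' c a h) * (Mf x $$ (c,b) * v b) + cnj (Mf x $$ (c,a) * v a) * (M' c b h * v b))"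
      by (intro sum.cong refl) (simp add: sum_distrib_left sum_distrib_right algebra_simps)
    also have "\<dots> = (\<Sum>c<m. \<Sum>a<n. \<Sum>b<n. cnj (v a * M' c a h) * (Mf x $$ (c,b) * v b) + cnj (Mf x $$ (c,a) * v a) * (M' c b h * v b))"
      by (simp only: sum.swap[of _ "{..<m}"])
    also have "\<dots> = (\<Sum>c<m. cnj (\<Sum>a<n. v a * M' c a h) * z c + cnj (z c) * (\<Sum>b<n. M' c b h * v b))"
      unfolding z_def cnj_sum sum_product by (simp only: sum.distrib)
    also have "\<dots> = (\<Sum>c<m. cnj (cnj (z c) * (\<Sum>b<n. M' c b h * v b)) + cnj (z c) * (\<Sum>b<n. M' c b h * v b))"
      by (simp add: mult.commute)
    also have "\<dots> = cnj (P h) + P h"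
      unfolding P_def by (simp add: sum.distrib sum_distrib_left mult.assoc)
    finally show ?thesis
      by (simp add: complex_add_cnj add.commute)
  qed
  moreover have "(\<Sum>a<n. complex_of_real ((cmod (v a))\<^sup>2)) = complex_of_real V"
    by (simp add: V_def)
  ultimately have "((\<lambda>y. complex_of_real ((s y)\<^sup>2)) has_derivative
      (\<lambda>h. complex_of_real (2 * Re (P h)) / complex_of_real V)) (at x)"
    by (simp only:)
  then have "((\<lambda>y. Re (complex_of_real ((s y)\<^sup>2))) has_derivative
      (\<lambda>h. Re (complex_of_real (2 * Re (P h)) / complex_of_real V))) (at x)"
    by (rule has_derivative_Re)
  then have "((\<lambda>y. (s y)\<^sup>2) has_derivative (\<lambda>h. 2 * Re (P h) / V)) (at x)"
    unfolding of_real_divide[symmetric] Re_complex_of_real .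
  \<comment> \<open>The square root is differentiable at (s x)^2, which is positive because s x is
    nonzero.\<close>
  then have "((\<lambda>y. sqrt ((s y)\<^sup>2)) has_derivative (\<lambda>h. 2 * Re (P h) / V * (inverse (sqrt ((s x)\<^sup>2)) / 2))) (at x)"
    using nz s0[of x] by (intro has_derivative_real_sqrt) (auto simp: s_def)
  moreover have "sqrt ((s y)\<^sup>2) = s y" for y
    using s0 by simp
  ultimately show ?thesis
    unfolding s_def[symmetric] P_def[symmetric] z_def[symmetric] V_def[symmetric]
    by (simp add: field_simps)
qed

text \<open>An eigenvector for the squared singular value always exists; this serves the points near
  the given one, where no singular vectors are prescribed.\<close>

lemma sing_val_differentiable:
  fixes Mf :: "'a::real_normed_vector \<Rightarrow> complex mat"
  assumes M: "\<And>y. Mf y \<in> carrier_mat m n"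
    and M': "\<And>c b. c < m \<Longrightarrow> b < n \<Longrightarrow> (\<lambda>y. Mf y $$ (c,b)) differentiable (at x)"
    and k: "k < n" and nz: "sing_vals (Mf x) ! k \<noteq> 0"
    and simple: "count (mset (sing_vals (Mf x))) (sing_vals (Mf x) ! k) = 1"
  shows "(\<lambda>y. sing_vals (Mf y) ! k) differentiable (at x)"
proof -
  have "sing_vals (Mf x) ! k \<in> set (sing_vals (Mf x))"
    using k length_sing_vals[OF M] by simp
  then obtain v where "\<exists>a<n. v a \<noteq> 0" "\<And>a. a < n \<Longrightarrow> (\<Sum>b<n. (cadj (Mf x) * Mf x) $$ (a,b) * v b)
      = complex_of_real ((sing_vals (Mf x) ! k)\<^sup>2) * v a"
    using eigenvalue_coords[OF gram_carrier[OF M] sing_val_root[OF M]] by blast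
  moreover obtain M' where "\<And>c b. c < m \<Longrightarrow> b < n \<Longrightarrow> ((\<lambda>y. Mf y $$ (c,b)) has_derivative M' c b) (at x)"
    using M' unfolding differentiable_def by metis
  ultimately show ?thesis
    unfolding differentiable_def using sing_val_has_derivative[where Mf = Mf, OF M _ k nz simple] by blast
qed

text \<open>Finitely many continuous differences stay nonzero around \<open>x\<close>. The filter
  can be \<open>nhds x\<close> because \<open>x\<close> itself satisfies both properties by
  hypothesis.\<close>

lemma eventually_sing_val_simple:
  fixes Mf :: "'a::first_countable_topology \<Rightarrow> complex mat"
  assumes M: "\<And>y. Mf y \<in> carrier_mat m n"
    and lim: "\<And>a b. a < m \<Longrightarrow> b < n \<Longrightarrow> ((\<lambda>y. Mf y $$ (a,b)) \<longlongrightarrow> Mf x $$ (a,b)) (at x)"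
    and k: "k < n" and nz: "sing_vals (Mf x) ! k \<noteq> 0"
    and simple: "count (mset (sing_vals (Mf x))) (sing_vals (Mf x) ! k) = 1"
  shows "\<forall>\<^sub>F y in nhds x. sing_vals (Mf y) ! k \<noteq> 0 \<and>
    count (mset (sing_vals (Mf y))) (sing_vals (Mf y) ! k) = 1"
proof -
  note s_lim = sing_vals_tendsto[of Mf m n x, OF M lim]
  have count: "count (mset (sing_vals (Mf y))) (sing_vals (Mf y) ! k) = 1
      \<longleftrightarrow> (\<forall>i<n. i \<noteq> k \<longrightarrow> sing_vals (Mf y) ! i - sing_vals (Mf y) ! k \<noteq> 0)" for y
    using count_mset_nth_eq_1_iff[of k "sing_vals (Mf y)"] k length_sing_vals[OF M] by simp
  have "\<forall>\<^sub>F y in at x. sing_vals (Mf y) ! k \<noteq> 0"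
    by (rule tendsto_imp_eventually_ne[OF s_lim[OF _ _ k] nz])
  moreover have "\<forall>\<^sub>F y in at x. \<forall>i\<in>{..<n} - {k}. sing_vals (Mf y) ! i - sing_vals (Mf y) ! k \<noteq> 0"
  proof (intro eventually_ball_finite ballI)
    fix i assume i: "i \<in> {..<n} - {k}"
    show "\<forall>\<^sub>F y in at x. sing_vals (Mf y) ! i - sing_vals (Mf y) ! k \<noteq> 0"
      using simple i unfolding count
      by (intro tendsto_imp_eventually_ne[OF tendsto_diff[OF s_lim s_lim]] k) auto
  qed simp
  ultimately have "\<forall>\<^sub>F y in at x. sing_vals (Mf y) ! k \<noteq> 0 \<and>
      count (mset (sing_vals (Mf y))) (sing_vals (Mf y) ! k) = 1"
    unfolding count by eventually_elim auto
  then show ?thesis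
    using nz simple by (simp add: eventually_nhds_conv_at)
qed

section \<open>Entrywise derivatives of matrix-valued maps\<close>

lemma invertible_mat_iff_det:
  fixes A :: "'a::field mat"
  assumes A: "A \<in> carrier_mat n n"
  shows "invertible_mat A \<longleftrightarrow> Determinant.det A \<noteq> 0"
proof
  assume "invertible_mat A"
  then obtain B where B: "A * B = 1\<^sub>m n" "B * A = 1\<^sub>m (dim_row B)"
    using A by (auto simp: invertible_mat_def inverts_mat_def)
  \<comment> \<open>\<open>invertible_mat\<close> leaves the shape of \<open>B\<close> open; the
    column counts of the two products fix it.\<close>
  have "B \<in> carrier_mat n n"
    using arg_cong[OF B(1), of dim_col] arg_cong[OF B(2), of dim_col] A by (auto intro: carrier_matI)
  then show "Determinant.det A \<noteq> 0"
    using arg_cong[OF B(1), of Determinant.det] by (auto simp: det_mult[OF A])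
next
  assume "Determinant.det A \<noteq> 0"
  then have "A \<in> Units (ring_mat TYPE('a) n ())"
    by (rule det_non_zero_imp_unit[OF A])
  then obtain B where "B \<in> carrier_mat n n" "A * B = 1\<^sub>m n" "B * A = 1\<^sub>m n"
    by (auto simp: Units_def ring_mat_def)
  then show "invertible_mat A"
    using A by (auto simp: invertible_mat_def inverts_mat_def square_mat.simps)
qed

text \<open>Covers singular \<open>A\<close> too, where \<open>minv\<close> is the zero matrix by
  convention, so maps built from \<open>minv\<close> have a fixed shape at every point.\<close>

lemma minv_carrier [simp]:
  assumes "A \<in> carrier_mat n n" shows "minv A \<in> carrier_mat n n"
  using assms mat_inverse(2)[OF assms] by (auto simp: minv_def split: option.split)

lemma minv_inverse:
  assumes A: "A \<in> carrier_mat n n" and det: "Determinant.det A \<noteq> 0"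
  shows "A * minv A = 1\<^sub>m n" "minv A * A = 1\<^sub>m n"
proof -
  have "mat_inverse A \<noteq> None"
    using mat_inverse(1)[OF A, of "()"] det_non_zero_imp_unit[OF A det, of "()"] by blast
  then show "A * minv A = 1\<^sub>m n" "minv A * A = 1\<^sub>m n"
    using mat_inverse(2)[OF A] by (auto simp: minv_def)
qed

text \<open>Cramer's rule, from minv A (A adj A) = det A minv A. It exhibits the inverse as a
  quotient of polynomials in the entries, hence as continuous.\<close>

lemma minv_index:
  assumes A: "A \<in> carrier_mat n n" and det: "Determinant.det A \<noteq> 0" and ij: "i < n" "j < n"
  shows "minv A $$ (i,j) = cofactor A j i / Determinant.det A"
proof -
  note adj = adj_mat[OF A]
  have "adj_mat A = (minv A * A) * adj_mat A"
    using adj(1) by (simp add: minv_inverse[OF A det])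
  also have "\<dots> = minv A * (Determinant.det A \<cdot>\<^sub>m 1\<^sub>m n)"
    using adj A by (simp add: assoc_mult_mat[of _ n n _ n _ n])
  also have "\<dots> = Determinant.det A \<cdot>\<^sub>m minv A"
    using minv_carrier[OF A] by (simp add: mult_smult_distrib[of _ n n _ n])
  finally have "adj_mat A $$ (i,j) = Determinant.det A * minv A $$ (i,j)"
    using ij carrier_matD[OF minv_carrier[OF A]] by simp
  then show ?thesis
    using det ij A by (simp add: adj_mat_def)
qed

text \<open>The Frechet derivative entry by entry. The shape is required at every point, and not
  only near \<open>x\<close>, so that the rules compose without side conditions on
  dimensions.\<close>

definition mat_deriv ::
  "nat \<Rightarrow> nat \<Rightarrow> ('a::real_normed_vector \<Rightarrow> 'b::real_normed_field mat) \<Rightarrow> ('a \<Rightarrow> 'b mat) \<Rightarrow> 'a \<Rightarrow> bool" where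
  "mat_deriv m n F F' x \<longleftrightarrow> (\<forall>y. F y \<in> carrier_mat m n) \<and> (\<forall>h. F' h \<in> carrier_mat m n) \<and>
    (\<forall>i<m. \<forall>j<n. ((\<lambda>y. F y $$ (i,j)) has_derivative (\<lambda>h. F' h $$ (i,j))) (at x))"

lemma mat_derivI:
  assumes "\<And>y. F y \<in> carrier_mat m n" "\<And>h. F' h \<in> carrier_mat m n"
    "\<And>i j. i < m \<Longrightarrow> j < n \<Longrightarrow> ((\<lambda>y. F y $$ (i,j)) has_derivative (\<lambda>h. F' h $$ (i,j))) (at x)"
  shows "mat_deriv m n F F' x"
  using assms by (simp add: mat_deriv_def)

lemma mat_derivD:
  assumes "mat_deriv m n F F' x"
  shows "F y \<in> carrier_mat m n" "F' h \<in> carrier_mat m n"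
    "i < m \<Longrightarrow> j < n \<Longrightarrow> ((\<lambda>y. F y $$ (i,j)) has_derivative (\<lambda>h. F' h $$ (i,j))) (at x)"
    "dim_row (F y) = m" "dim_col (F y) = n" "dim_row (F' h) = m" "dim_col (F' h) = n"
  using assms carrier_matD[of "F y" m n] carrier_matD[of "F' h" m n] unfolding mat_deriv_def by blast+

lemma mat_deriv_tendsto:
  assumes "mat_deriv m n F F' x" "i < m" "j < n"
  shows "((\<lambda>y. F y $$ (i,j)) \<longlongrightarrow> F x $$ (i,j)) (at x)"
  using has_derivative_continuous[OF mat_derivD(3)[OF assms]] by (simp add: continuous_within)

lemma mat_deriv_const: "A \<in> carrier_mat m n \<Longrightarrow> mat_deriv m n (\<lambda>y. A) (\<lambda>h. 0\<^sub>m m n) x"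
  by (rule mat_derivI) auto

lemma mat_deriv_add:
  assumes F: "mat_deriv m n F F' x" and G: "mat_deriv m n G G' x"
  shows "mat_deriv m n (\<lambda>y. F y + G y) (\<lambda>h. F' h + G' h) x"
  by (rule mat_derivI) (auto simp: mat_derivD[OF F] mat_derivD[OF G] intro!: derivative_intros mat_derivD(3)[OF F] mat_derivD(3)[OF G])

lemma mat_deriv_minus:
  assumes F: "mat_deriv m n F F' x" and G: "mat_deriv m n G G' x"
  shows "mat_deriv m n (\<lambda>y. F y - G y) (\<lambda>h. F' h - G' h) x"
  by (rule mat_derivI) (auto simp: mat_derivD[OF F] mat_derivD[OF G] minus_carrier_mat[OF mat_derivD(1)[OF G]]
      minus_carrier_mat[OF mat_derivD(2)[OF G]] intro!: derivative_intros mat_derivD(3)[OF F] mat_derivD(3)[OF G])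

lemma mat_deriv_transpose:
  assumes F: "mat_deriv m n F F' x"
  shows "mat_deriv n m (\<lambda>y. transpose_mat (F y)) (\<lambda>h. transpose_mat (F' h)) x"
  by (rule mat_derivI) (auto simp: mat_derivD[OF F] intro!: mat_derivD(3)[OF F])

lemma mat_deriv_mult:
  assumes F: "mat_deriv m k F F' x" and G: "mat_deriv k n G G' x"
  shows "mat_deriv m n (\<lambda>y. F y * G y) (\<lambda>h. F' h * G x + F x * G' h) x"
proof (rule mat_derivI)
  note FG = mat_derivD(1,2)[OF F] mat_derivD(1,2)[OF G]
  fix i j assume ij: "i < m" "j < n"
  have "((\<lambda>y. \<Sum>c<k. F y $$ (i,c) * G y $$ (c,j)) has_derivative
      (\<lambda>h. \<Sum>c<k. F x $$ (i,c) * G' h $$ (c,j) + F' h $$ (i,c) * G x $$ (c,j))) (at x)"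
    using ij by (intro has_derivative_sum has_derivative_mult mat_derivD(3)[OF F] mat_derivD(3)[OF G]) auto
  moreover have "(F' h * G x + F x * G' h) $$ (i,j)
      = (\<Sum>c<k. F x $$ (i,c) * G' h $$ (c,j) + F' h $$ (i,c) * G x $$ (c,j))" for h
    using ij mat_derivD(4-7)[OF F] mat_derivD(4-7)[OF G]
    by (subst index_add_mat) (auto simp: index_mult_sum[OF FG(1,4) ij] index_mult_sum[OF FG(2,3) ij] sum.distrib simp del: index_mult_mat(1))
  ultimately show "((\<lambda>y. (F y * G y) $$ (i,j)) has_derivative (\<lambda>h. (F' h * G x + F x * G' h) $$ (i,j))) (at x)"
    by (simp only: index_mult_sum[OF FG(1,3) ij])
qed (use mat_derivD(1,2)[OF F] mat_derivD(1,2)[OF G] in \<open>auto intro!: add_carrier_mat mult_carrier_mat[of _ m k _ n]\<close>)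

lemma mat_deriv_cm:
  assumes F: "mat_deriv m n F F' x"
  shows "mat_deriv m n (\<lambda>y. cm (F y)) (\<lambda>h. cm (F' h)) x"
  by (rule mat_derivI) (auto simp: cm_def mat_derivD[OF F] intro!: has_derivative_of_real mat_derivD(3)[OF F])

lemma mat_deriv_pcomb:
  assumes F: "\<And>i. i < \<kappa> \<Longrightarrow> mat_deriv m n (F i) (F' i) x"
  shows "mat_deriv m n (\<lambda>y. pcomb m n \<kappa> f p (\<lambda>i. F i y)) (\<lambda>h. pcomb m n \<kappa> f p (\<lambda>i. F' i h)) x"
proof (rule mat_derivI)
  fix i j assume ij: "i < m" "j < n"
  have "((\<lambda>y. \<Sum>k<\<kappa>. f k p * F k y $$ (i,j)) has_derivative (\<lambda>h. \<Sum>k<\<kappa>. f k p * F' k h $$ (i,j))) (at x)"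
    using ij by (intro has_derivative_sum has_derivative_mult_right mat_derivD(3)[OF F]) auto
  then show "((\<lambda>y. pcomb m n \<kappa> f p (\<lambda>i. F i y) $$ (i,j)) has_derivative
      (\<lambda>h. pcomb m n \<kappa> f p (\<lambda>i. F' i h) $$ (i,j))) (at x)"
    using ij by (simp add: pcomb_def)
qed (auto simp: pcomb_def)

text \<open>Resolvent identity: the increment of the inverse is
  \<open>- minv (D y) * (D y - D x) * minv (D x)\<close>, so continuity of the inverse gives its derivative.\<close>

lemma mat_deriv_minv:
  assumes D: "mat_deriv n n D D' x" and det: "Determinant.det (D x) \<noteq> 0"
  shows "mat_deriv n n (\<lambda>y. minv (D y)) (\<lambda>h. - (minv (D x) * D' h * minv (D x))) x"
proof (rule mat_derivI)
  note Dc = mat_derivD(1,2)[OF D]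
  note mc = minv_carrier[OF Dc(1)]
  fix i j assume ij: "i < n" "j < n"
  have det_lim: "((\<lambda>y. Determinant.det (D y)) \<longlongrightarrow> Determinant.det (D x)) (at x)"
    by (rule tendsto_det[OF Dc(1) Dc(1) mat_deriv_tendsto[OF D]])
  have ev: "\<forall>\<^sub>F y in at x. Determinant.det (D y) \<noteq> 0"
    by (rule tendsto_imp_eventually_ne[OF det_lim det])
  \<comment> \<open>Cramer's formula holds where the determinant is nonzero, which is the case near
    \<open>x\<close>; the default value of \<open>minv\<close> never enters the limit.\<close>
  have minv_lim: "((\<lambda>y. minv (D y) $$ (a,b)) \<longlongrightarrow> minv (D x) $$ (a,b)) (at x)" if "a < n" "b < n" for a b
  proof (rule Lim_transform_eventually)
    show "((\<lambda>y. cofactor (D y) b a / Determinant.det (D y)) \<longlongrightarrow> minv (D x) $$ (a,b)) (at x)"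
      unfolding minv_index[OF Dc(1) det that]
      by (intro tendsto_divide det_lim det cofactor_tendsto[where n = n] Dc mat_deriv_tendsto[OF D])
    show "\<forall>\<^sub>F y in at x. cofactor (D y) b a / Determinant.det (D y) = minv (D y) $$ (a,b)"
      using ev by eventually_elim (simp add: minv_index[OF Dc(1) _ that])
  qed
  \<comment> \<open>Entry (i,j) of the resolvent identity solved for minv (D y), with minv (D y) as
    the factor that only needs a limit.\<close>
  define f where "f y = minv (D x) $$ (i,j)
    - (\<Sum>b<n. \<Sum>a<n. minv (D y) $$ (i,a) * ((D y $$ (a,b) - D x $$ (a,b)) * minv (D x) $$ (b,j)))" for y
  have triple: "(A * B * C) $$ (i,j) = (\<Sum>b<n. \<Sum>a<n. A $$ (i,a) * (B $$ (a,b) * C $$ (b,j)))"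
    if "A \<in> carrier_mat n n" "B \<in> carrier_mat n n" "C \<in> carrier_mat n n" for A B C :: "complex mat"
    using that ij
    by (simp add: index_mult_sum[of _ n n _ n] sum_distrib_left del: index_mult_mat(1)) (rule sum.swap)
  have f_eq: "f y = minv (D y) $$ (i,j)" if y: "Determinant.det (D y) \<noteq> 0" for y
  proof -
    have "minv (D y) * (D y - D x) * minv (D x) = (minv (D y) * D y) * minv (D x) - minv (D y) * (D x * minv (D x))"
      using Dc mc mult_carrier_mat[OF mc Dc(1)]
      by (simp add: mult_minus_distrib_mat[of _ n n _ n] minus_mult_distrib_mat[of _ n n _ _ n]
          assoc_mult_mat[of _ n n _ n _ n])
    also have "\<dots> = minv (D x) - minv (D y)"
      by (simp add: minv_inverse[OF Dc(1) y] minv_inverse[OF Dc(1) det]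
          left_mult_one_mat[OF mc] right_mult_one_mat[OF mc])
    finally have "(minv (D y) * (D y - D x) * minv (D x)) $$ (i,j) = minv (D x) $$ (i,j) - minv (D y) $$ (i,j)"
      using ij mc carrier_matD[OF mc] by simp
    then show ?thesis
      unfolding f_def using triple[OF mc minus_carrier_mat[OF Dc(1)] mc, of y "D y" x x] carrier_matD[OF Dc(1)]
      by simp
  qed
  have "(f has_derivative (\<lambda>h. 0 - (\<Sum>b<n. \<Sum>a<n. minv (D x) $$ (i,a) * (D' h $$ (a,b) * minv (D x) $$ (b,j))))) (at x)"
    unfolding f_def
  proof (intro has_derivative_diff has_derivative_const has_derivative_sum has_derivative_mult_vanishing)
    fix a b assume ab: "b \<in> {..<n}" "a \<in> {..<n}"
    then have "((\<lambda>y. D y $$ (a,b) - D x $$ (a,b)) has_derivative (\<lambda>h. D' h $$ (a,b))) (at x)"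
      using has_derivative_diff[OF mat_derivD(3)[OF D] has_derivative_const, of a b] by simp
    then show "((\<lambda>y. (D y $$ (a,b) - D x $$ (a,b)) * minv (D x) $$ (b,j)) has_derivative
        (\<lambda>h. D' h $$ (a,b) * minv (D x) $$ (b,j))) (at x)"
      by (rule has_derivative_mult_left)
    show "((\<lambda>y. minv (D y) $$ (i,a)) \<longlongrightarrow> minv (D x) $$ (i,a)) (at x)"
      using ab ij by (intro minv_lim) auto
  qed simp
  moreover have "(- (minv (D x) * D' h * minv (D x))) $$ (i,j)
      = 0 - (\<Sum>b<n. \<Sum>a<n. minv (D x) $$ (i,a) * (D' h $$ (a,b) * minv (D x) $$ (b,j)))" for h
    using triple[OF mc Dc(2) mc] ij carrier_matD[OF mc] by simp
  ultimately have "(f has_derivative (\<lambda>h. (- (minv (D x) * D' h * minv (D x))) $$ (i,j))) (at x)"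
    by simp
  then show "((\<lambda>y. minv (D y) $$ (i,j)) has_derivative (\<lambda>h. (- (minv (D x) * D' h * minv (D x))) $$ (i,j))) (at x)"
    by (rule has_derivative_transform_eventually) (use ev f_eq det in \<open>auto elim: eventually_mono\<close>)
qed (use minv_carrier[OF mat_derivD(1)[OF D]] mat_derivD(2)[OF D] in \<open>auto intro!: uminus_carrier_mat mult_carrier_mat\<close>)

text \<open>The parameter stays an abstract family of bounded linear coordinates: blocks are then
  linear in the point, and their derivative in direction \<open>h\<close> is the same block read
  from \<open>\<theta> h\<close>.\<close>

lemma bounded_linear_blk: "bounded_linear (\<lambda>x. blk (\<theta> x) off k)"
  if "\<And>k. bounded_linear (\<lambda>x. \<theta> x k)"
  using that by (simp add: blk_def)

lemma mat_deriv_vtm: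
  assumes "\<And>k. bounded_linear (\<lambda>x. w x k)"
  shows "mat_deriv m n (\<lambda>x. vtm m n (w x)) (\<lambda>h. vtm m n (w h)) x"
  by (rule mat_derivI) (auto simp: vtm_def intro!: bounded_linear_imp_has_derivative assms)

lemma mat_deriv_vtu:
  assumes "\<And>k. bounded_linear (\<lambda>x. w x k)"
  shows "mat_deriv n n (\<lambda>x. vtu n (w x)) (\<lambda>h. vtu n (w h)) x"
proof (rule mat_derivI)
  fix i j assume "i < n" "j < n"
  then show "((\<lambda>x. vtu n (w x) $$ (i,j)) has_derivative (\<lambda>h. vtu n (w h) $$ (i,j))) (at x)"
    using bounded_linear_imp_has_derivative[OF assms] by (cases "i \<le> j") (auto simp: vtu_def)
qed (auto simp: vtu_def)

lemma mat_deriv_vtsu: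
  assumes "\<And>k. bounded_linear (\<lambda>x. w x k)"
  shows "mat_deriv n n (\<lambda>x. vtsu n (w x)) (\<lambda>h. vtsu n (w h)) x"
proof (rule mat_derivI)
  fix i j assume "i < n" "j < n"
  then show "((\<lambda>x. vtsu n (w x) $$ (i,j)) has_derivative (\<lambda>h. vtsu n (w h) $$ (i,j))) (at x)"
    using bounded_linear_imp_has_derivative[OF assms] by (cases "i < j") (auto simp: vtsu_def)
qed (auto simp: vtsu_def)

definition vtu_sq_deriv :: "nat \<Rightarrow> (nat \<Rightarrow> real) \<Rightarrow> (nat \<Rightarrow> real) \<Rightarrow> real mat" where
  "vtu_sq_deriv n w dw = vtu n dw * transpose_mat (vtu n w) + vtu n w * transpose_mat (vtu n dw)"

lemma mat_deriv_vtu_sq: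
  assumes "\<And>k. bounded_linear (\<lambda>x. w x k)"
  shows "mat_deriv n n (\<lambda>x. vtu n (w x) * transpose_mat (vtu n (w x))) (\<lambda>h. vtu_sq_deriv n (w x) (w h)) x"
  unfolding vtu_sq_deriv_def by (intro mat_deriv_mult[of n n] mat_deriv_transpose mat_deriv_vtu assms)

section \<open>Trace pairing and vectorizations\<close>

definition tr :: "'a::comm_semiring_0 mat \<Rightarrow> 'a" where
  "tr A = (\<Sum>i<dim_row A. A $$ (i,i))"

lemma tr_mult:
  assumes "A \<in> carrier_mat n m" "B \<in> carrier_mat m n"
  shows "tr (A * B) = (\<Sum>i<n. \<Sum>c<m. A $$ (i,c) * B $$ (c,i))"
  using assms by (simp add: tr_def index_mult_sum[of A n m B n] del: index_mult_mat(1))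

lemma tr_mult_comm:
  assumes "A \<in> carrier_mat n m" "B \<in> carrier_mat m n"
  shows "tr (A * B) = tr (B * A)"
  unfolding tr_mult[OF assms] tr_mult[OF assms(2,1)] by (subst sum.swap) (simp add: mult.commute)

lemma tr_transpose: "A \<in> carrier_mat n n \<Longrightarrow> tr (transpose_mat A) = tr A"
  by (auto simp: tr_def)

lemma tr_add:
  "A \<in> carrier_mat n n \<Longrightarrow> B \<in> carrier_mat n n \<Longrightarrow> tr (A + B) = tr A + tr B"
  by (simp add: tr_def sum.distrib)

lemma tr_minus:
  fixes A :: "'a::comm_ring mat"
  shows "A \<in> carrier_mat n n \<Longrightarrow> B \<in> carrier_mat n n \<Longrightarrow> tr (A - B) = tr A - tr B"
  by (simp add: tr_def sum_subtractf)

lemma cm_carrier [simp]: "A \<in> carrier_mat m n \<Longrightarrow> cm A \<in> carrier_mat m n"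
  by (simp add: cm_def)

lemma cm_add: "A \<in> carrier_mat m n \<Longrightarrow> B \<in> carrier_mat m n \<Longrightarrow> cm (A + B) = cm A + cm B"
  by (auto simp: cm_def)

lemma cm_minus: "A \<in> carrier_mat m n \<Longrightarrow> B \<in> carrier_mat m n \<Longrightarrow> cm (A - B) = cm A - cm B"
  by (auto simp: cm_def)

lemma cm_transpose: "cm (transpose_mat A) = transpose_mat (cm A)"
  by (auto simp: cm_def)

lemma cm_mult:
  assumes "A \<in> carrier_mat m k" "B \<in> carrier_mat k n"
  shows "cm (A * B) = cm A * cm B"
proof (rule eq_matI)
  fix i j assume "i < dim_row (cm A * cm B)" "j < dim_col (cm A * cm B)"
  then have ij: "i < m" "j < n" using assms by (auto simp: cm_def)
  have "cm (A * B) $$ (i,j) = complex_of_real ((A * B) $$ (i,j))"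
    using ij assms by (simp add: cm_def)
  also have "\<dots> = (cm A * cm B) $$ (i,j)"
    unfolding index_mult_sum[OF assms ij] index_mult_sum[OF cm_carrier cm_carrier, OF assms ij]
    using ij assms by (simp add: cm_def)
  finally show "cm (A * B) $$ (i,j) = (cm A * cm B) $$ (i,j)" .
qed (use assms in \<open>auto simp: cm_def\<close>)

lemma pcomb_carrier [simp]: "pcomb m n \<kappa> f p M \<in> carrier_mat m n"
  by (simp add: pcomb_def)

lemma tr_mult_pcomb:
  assumes Y: "Y \<in> carrier_mat n m" and M: "\<And>k. k < \<kappa> \<Longrightarrow> M k \<in> carrier_mat m n"
  shows "tr (Y * cm (pcomb m n \<kappa> f p M)) = (\<Sum>k<\<kappa>. tr ((complex_of_real (f k p) \<cdot>\<^sub>m Y) * cm (M k)))"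
proof -
  have "tr (Y * cm (pcomb m n \<kappa> f p M))
      = (\<Sum>i<n. \<Sum>c<m. Y $$ (i,c) * cm (pcomb m n \<kappa> f p M) $$ (c,i))"
    by (rule tr_mult[OF Y]) simp
  also have "\<dots> = (\<Sum>i<n. \<Sum>c<m. \<Sum>k<\<kappa>. (complex_of_real (f k p) \<cdot>\<^sub>m Y) $$ (i,c) * cm (M k) $$ (c,i))"
    using Y carrier_matD[OF M] by (intro sum.cong refl) (auto simp: pcomb_def cm_def sum_distrib_left intro!: sum.cong)
  also have "\<dots> = (\<Sum>k<\<kappa>. \<Sum>i<n. \<Sum>c<m. (complex_of_real (f k p) \<cdot>\<^sub>m Y) $$ (i,c) * cm (M k) $$ (c,i))"
    by (simp only: sum.swap[of _ "{..<\<kappa>}"])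
  also have "\<dots> = (\<Sum>k<\<kappa>. tr ((complex_of_real (f k p) \<cdot>\<^sub>m Y) * cm (M k)))"
    using Y M by (intro sum.cong refl) (simp add: tr_mult[of _ n m])
  finally show ?thesis .
qed

text \<open>A gradient list acting as a linear functional on directions. The direction is a function
  on positions, so passing to a block is a shift of its argument.\<close>

definition pairing :: "'a::comm_semiring_0 list \<Rightarrow> (nat \<Rightarrow> 'a) \<Rightarrow> 'a" where
  "pairing xs g = (\<Sum>k<length xs. xs ! k * g k)"

lemma pairing_Nil [simp]: "pairing [] g = 0"
  by (simp add: pairing_def)

lemma pairing_snoc: "pairing (xs @ [x]) g = pairing xs g + x * g (length xs)"
  by (simp add: pairing_def nth_append)

lemma pairing_append: "pairing (xs @ ys) g = pairing xs g + pairing ys (\<lambda>k. g (length xs + k))"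
proof (induction ys rule: rev_induct)
  case (snoc y ys)
  then show ?case
    using pairing_snoc[of "xs @ ys" y g] by (simp add: pairing_snoc add.assoc)
qed simp

lemma length_concat_map_upt: "length (concat (map F [0..<n])) = (\<Sum>t<n. length (F t))"
  by (induction n) simp_all

text \<open>Piece \<open>i\<close> starts at the total length of its predecessors. For the rows of a
  triangle this is the very sum in \<open>utidx\<close> and \<open>sutidx\<close>, so extraction and
  filling use the same positions.\<close>

lemma pairing_concat:
  "pairing (concat (map F [0..<n])) g = (\<Sum>i<n. pairing (F i) (\<lambda>k. g ((\<Sum>t<i. length (F t)) + k)))"
  by (induction n) (simp_all add: pairing_append length_concat_map_upt)

lemma pairing_concat_blocks:
  assumes "\<And>k. k < \<kappa> \<Longrightarrow> length (F k) = L"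
  shows "pairing (concat (map F [0..<\<kappa>])) g = (\<Sum>k<\<kappa>. pairing (F k) (\<lambda>t. g (k * L + t)))"
  using assms unfolding pairing_concat by (auto intro!: sum.cong)

lemma pairing_map_upt: "pairing (map f [a..<b]) g = (\<Sum>t\<in>{a..<b}. f t * g (t - a))"
  unfolding pairing_def
  by (rule sum.reindex_bij_witness[of _ "\<lambda>t. t - a" "\<lambda>k. a + k"]) auto

lemma pairing_uminus: "pairing (map (\<lambda>z. - Re z) xs) g = - pairing (map Re xs) g"
  by (simp add: pairing_def sum_negf)

section \<open>Vectorisations as trace functionals\<close>

lemma length_ftv [simp]: "length (ftv M) = dim_col M * dim_row M"
  by (simp add: ftv_def length_concat_map_upt)

lemma sum_diff_triangle: "(\<Sum>t<n. n - t) = n * (n + 1) div 2" for n :: nat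
proof -
  have "(\<Sum>t<n. n - t) = (\<Sum>t<n. Suc t)"
    by (rule sum.reindex_bij_witness[of _ "\<lambda>t. n - Suc t" "\<lambda>t. n - Suc t"]) auto
  also have "\<dots> = n * (n + 1) div 2"
    by (induction n) auto
  finally show ?thesis .
qed

lemma sum_diff_triangle_strict: "(\<Sum>t<n. n - Suc t) = n * (n - 1) div 2" for n :: nat
proof -
  have "(\<Sum>t<n. n - Suc t) = (\<Sum>t<n. t)"
    by (rule sum.reindex_bij_witness[of _ "\<lambda>t. n - Suc t" "\<lambda>t. n - Suc t"]) auto
  also have "\<dots> = n * (n - 1) div 2"
    using Sum_Ico_nat[of 0 n] by (simp add: lessThan_atLeast0)
  finally show ?thesis .
qed

lemma length_utv: "M \<in> carrier_mat n n \<Longrightarrow> length (utv M) = n * (n + 1) div 2"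
  using sum_diff_triangle[of n] by (simp add: utv_def length_concat_map_upt)

lemma length_sutv: "M \<in> carrier_mat n n \<Longrightarrow> length (sutv M) = n * (n - 1) div 2"
  using sum_diff_triangle_strict[of n] by (simp add: sutv_def length_concat_map_upt)

text \<open>tr (Y X) pairs entry (b,a) of Y with entry (a,b) of X; hence the transpose before the
  column-major reading in the gradient blocks.\<close>

lemma pairing_ftv:
  assumes Y: "Y \<in> carrier_mat n m"
  shows "pairing (map Re (ftv (transpose_mat Y))) w = Re (tr (Y * cm (vtm m n w)))"
proof -
  have "pairing (map Re (ftv (transpose_mat Y))) w
      = (\<Sum>b<n. \<Sum>a<m. Re (Y $$ (b,a)) * w (b * m + a))"
    using Y by (simp add: ftv_def map_concat o_def pairing_concat pairing_map_upt lessThan_atLeast0)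
  also have "\<dots> = (\<Sum>b<n. \<Sum>a<m. Re (Y $$ (b,a) * cm (vtm m n w) $$ (a,b)))"
    by (intro sum.cong refl) (simp add: cm_def vtm_def)
  also have "\<dots> = Re (tr (Y * cm (vtm m n w)))"
    by (subst tr_mult[OF Y]) (auto simp: vtm_def)
  finally show ?thesis .
qed

text \<open>The entries of \<open>X\<close> below the diagonal meet zeros of \<open>vtu\<close>, so
  the sum over the upper triangle extends to a full trace.\<close>

lemma pairing_utv:
  assumes X: "X \<in> carrier_mat n n"
  shows "pairing (map Re (utv X)) w = Re (tr (transpose_mat X * cm (vtu n w)))"
proof -
  have "pairing (map Re (utv X)) w = (\<Sum>a<n. \<Sum>b\<in>{a..<n}. Re (X $$ (a,b)) * w (utidx n a b))"
    using X by (simp add: utv_def map_concat o_def pairing_concat pairing_map_upt utidx_def)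
  also have "\<dots> = (\<Sum>a<n. \<Sum>b<n. Re (X $$ (a,b) * cm (vtu n w) $$ (a,b)))"
  proof (rule sum.cong[OF refl])
    fix a assume a: "a \<in> {..<n}"
    show "(\<Sum>b\<in>{a..<n}. Re (X $$ (a,b)) * w (utidx n a b)) = (\<Sum>b<n. Re (X $$ (a,b) * cm (vtu n w) $$ (a,b)))"
      using a by (intro sum.mono_neutral_cong_left) (auto simp: cm_def vtu_def)
  qed
  also have "\<dots> = Re (tr (transpose_mat X * cm (vtu n w)))"
    using X by (subst tr_mult[of _ n n], simp, simp add: vtu_def, subst sum.swap) simp
  finally show ?thesis .
qed

lemma pairing_sutv:
  assumes X: "X \<in> carrier_mat n n"
  shows "pairing (map Re (sutv X)) w = Re (tr (transpose_mat X * cm (vtsu n w)))"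
proof -
  have "pairing (map Re (sutv X)) w = (\<Sum>a<n. \<Sum>b\<in>{Suc a..<n}. Re (X $$ (a,b)) * w (sutidx n a b))"
    using X by (simp add: sutv_def map_concat o_def pairing_concat pairing_map_upt sutidx_def)
  also have "\<dots> = (\<Sum>a<n. \<Sum>b<n. Re (X $$ (a,b) * cm (vtsu n w) $$ (a,b)))"
  proof (rule sum.cong[OF refl])
    fix a assume a: "a \<in> {..<n}"
    show "(\<Sum>b\<in>{Suc a..<n}. Re (X $$ (a,b)) * w (sutidx n a b)) = (\<Sum>b<n. Re (X $$ (a,b) * cm (vtsu n w) $$ (a,b)))"
      using a by (intro sum.mono_neutral_cong_left) (auto simp: cm_def vtsu_def)
  qed
  also have "\<dots> = Re (tr (transpose_mat X * cm (vtsu n w)))"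
    using X by (subst tr_mult[of _ n n], simp, simp add: vtsu_def, subst sum.swap) simp
  finally show ?thesis .
qed

lemma map2_concat_map:
  "map2 f (concat (map (\<lambda>a. map (F a) (L a)) xs)) (concat (map (\<lambda>a. map (G a) (L a)) xs))
    = concat (map (\<lambda>a. map (\<lambda>b. f (F a b) (G a b)) (L a)) xs)"
  by (induction xs) (simp_all add: zip_map_map o_def zip_same_conv_map)

lemma map2_sutv:
  assumes "A \<in> carrier_mat n n" "B \<in> carrier_mat n n"
  shows "map2 (\<lambda>a b. Re (a - b)) (sutv A) (sutv B) = map Re (sutv (A - B))"
proof -
  have "map2 (\<lambda>a b. Re (a - b)) (sutv A) (sutv B)
      = concat (map (\<lambda>a. map (\<lambda>b. Re (A $$ (a,b) - B $$ (a,b))) [Suc a..<n]) [0..<n])"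
    using assms by (simp add: sutv_def map2_concat_map)
  also have "\<dots> = map Re (sutv (A - B))"
    using assms by (auto simp: sutv_def map_concat o_def intro!: arg_cong[of _ _ concat])
  finally show ?thesis .
qed

text \<open>Summing over the blocks reassembles the weighted combination \<open>pcomb\<close>, so
  that a single trace against \<open>Y\<close> remains.\<close>

lemma pairing_blocks_vtm:
  assumes Y: "Y \<in> carrier_mat n m"
  shows "(\<Sum>k<\<kappa>. pairing (map (\<lambda>z. - Re z) (ftv (transpose_mat (complex_of_real (f k p) \<cdot>\<^sub>m Y)))) (w k))
    = - Re (tr (Y * cm (pcomb m n \<kappa> f p (\<lambda>k. vtm m n (w k)))))"
proof -
  have "vtm m n (w k) \<in> carrier_mat m n" for k by (simp add: vtm_def)
  then show ?thesis
    using Y by (simp add: tr_mult_pcomb pairing_uminus pairing_ftv[of _ n m] sum_negf)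
qed

text \<open>For strictly triangular S, tr ((X - X^T)^T S) = tr (X S^T) - tr (X S) = - tr (X (S -
  S^T)). This sign is why the J blocks of the gradient carry no minus of their own.\<close>

lemma pairing_blocks_skew:
  assumes Y: "Y \<in> carrier_mat n n"
  shows "(\<Sum>k<\<kappa>. pairing (map2 (\<lambda>a b. Re (a - b)) (sutv (complex_of_real (f k p) \<cdot>\<^sub>m Y))
      (sutv (transpose_mat (complex_of_real (f k p) \<cdot>\<^sub>m Y)))) (w k))
    = - Re (tr (Y * cm (pcomb n n \<kappa> f p (\<lambda>k. vtsu n (w k) - transpose_mat (vtsu n (w k))))))"
proof -
  have S: "vtsu n (w k) \<in> carrier_mat n n" for k by (simp add: vtsu_def)
  have "pairing (map2 (\<lambda>a b. Re (a - b)) (sutv X) (sutv (transpose_mat X))) (w k)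
      = - Re (tr (X * cm (vtsu n (w k) - transpose_mat (vtsu n (w k)))))"
    if X: "X \<in> carrier_mat n n" for X k
  proof -
    let ?S = "cm (vtsu n (w k))"
    have S': "?S \<in> carrier_mat n n" using S by simp
    have "transpose_mat (X - transpose_mat X) * ?S = transpose_mat X * ?S - X * ?S"
      using X S' by (simp add: transpose_minus[of _ n n] minus_mult_distrib_mat[of _ n n _ _ n])
    then have "pairing (map2 (\<lambda>a b. Re (a - b)) (sutv X) (sutv (transpose_mat X))) (w k)
        = Re (tr (transpose_mat X * ?S)) - Re (tr (X * ?S))"
      using X S' mult_carrier_mat[OF X S'] mult_carrier_mat[OF _ S', of "transpose_mat X" n]
      by (simp add: map2_sutv[of _ n, simplified] pairing_sutv[of _ n] minus_carrier_mat[of _ n n] tr_minus[of _ n])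
    also have "tr (transpose_mat X * ?S) = tr (X * transpose_mat ?S)"
    proof -
      have "tr (transpose_mat X * ?S) = tr (transpose_mat (transpose_mat X * ?S))"
        using X S' by (subst tr_transpose) auto
      also have "\<dots> = tr (transpose_mat ?S * X)"
        using X S' by (simp add: transpose_mult[of _ n n _ n])
      also have "\<dots> = tr (X * transpose_mat ?S)"
        using X S' by (intro tr_mult_comm) auto
      finally show ?thesis .
    qed
    also have "Re (tr (X * transpose_mat ?S)) - Re (tr (X * ?S)) = - Re (tr (X * cm (vtsu n (w k) - transpose_mat (vtsu n (w k)))))"
      using X S S' by (simp add: cm_minus[of _ n n] cm_transpose mult_minus_distrib_mat[of _ n n _ n] tr_minus[of _ n])
    finally show ?thesis .
  qed
  then show ?thesis
    using Y S by (simp add: tr_mult_pcomb minus_carrier_mat[of _ n n] sum_negf)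
qed

text \<open>With L the triangular factor and D its increment, tr ((X L + X^T L)^T D) = tr (X L D^T)
  + tr (X D L^T), by transposing the first trace and cycling both. The right side is X against the
  derivative of L L^T.\<close>

lemma pairing_blocks_sq:
  assumes Y: "Y \<in> carrier_mat n n"
  shows "(\<Sum>k<\<kappa>. pairing (map Re (utv ((complex_of_real (f k p) \<cdot>\<^sub>m Y) * cm (vtu n (w0 k))
      + transpose_mat (complex_of_real (f k p) \<cdot>\<^sub>m Y) * cm (vtu n (w0 k))))) (w k))
    = Re (tr (Y * cm (pcomb n n \<kappa> f p (\<lambda>k. vtu_sq_deriv n (w0 k) (w k)))))"
proof -
  have U [simp]: "vtu n x \<in> carrier_mat n n" for x :: "nat \<Rightarrow> real" by (simp add: vtu_def)
  have vtu_sq_deriv: "vtu_sq_deriv n x y \<in> carrier_mat n n" for x y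
    unfolding vtu_sq_deriv_def by (intro add_carrier_mat mult_carrier_mat[of _ n n]) auto
  have "pairing (map Re (utv (X * cm (vtu n x) + transpose_mat X * cm (vtu n x)))) y = Re (tr (X * cm (vtu_sq_deriv n x y)))"
    if X: "X \<in> carrier_mat n n" for X x y
  proof -
    let ?L = "cm (vtu n x)" and ?D = "cm (vtu n y)"
    have L: "?L \<in> carrier_mat n n" "?D \<in> carrier_mat n n" by simp_all
    have LT: "transpose_mat ?L \<in> carrier_mat n n" "transpose_mat ?D \<in> carrier_mat n n"
      "transpose_mat X \<in> carrier_mat n n"
      using L X by auto
    have XL: "X * ?L \<in> carrier_mat n n" "transpose_mat X * ?L \<in> carrier_mat n n"
      "transpose_mat (X * ?L) \<in> carrier_mat n n" "transpose_mat ?L * X \<in> carrier_mat n n"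
      "?L * transpose_mat ?D \<in> carrier_mat n n" "?D * transpose_mat ?L \<in> carrier_mat n n"
      using X L by (auto intro!: mult_carrier_mat[of _ n n])
    have "transpose_mat (X * ?L + transpose_mat X * ?L) * ?D
        = transpose_mat (X * ?L) * ?D + (transpose_mat ?L * X) * ?D"
      using XL L X LT add_mult_distrib_mat[OF XL(3,4) L(2)] by (simp add: transpose_add[of _ n n] transpose_mult[of _ n n _ n])
    then have "pairing (map Re (utv (X * ?L + transpose_mat X * ?L))) y
        = Re (tr (transpose_mat (X * ?L) * ?D)) + Re (tr ((transpose_mat ?L * X) * ?D))"
      using XL L by (simp add: pairing_utv[of _ n] tr_add[of _ n] mult_carrier_mat[of _ n n _ n] del: assoc_mult_mat)
    also have "tr (transpose_mat (X * ?L) * ?D) = tr (transpose_mat (transpose_mat (X * ?L) * ?D))"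
      using XL L by (subst tr_transpose[of _ n]) (auto intro!: mult_carrier_mat[of _ n n])
    also have "transpose_mat (transpose_mat (X * ?L) * ?D) = transpose_mat ?D * (X * ?L)"
      using XL L by (simp add: transpose_mult[of _ n n _ n])
    also have "tr (transpose_mat ?D * (X * ?L)) = tr ((X * ?L) * transpose_mat ?D)"
      by (rule tr_mult_comm[OF LT(2) XL(1)])
    also have "(X * ?L) * transpose_mat ?D = X * (?L * transpose_mat ?D)"
      by (rule assoc_mult_mat[OF X L(1) LT(2)])
    also have "(transpose_mat ?L * X) * ?D = transpose_mat ?L * (X * ?D)"
      by (rule assoc_mult_mat[OF LT(1) X L(2)])
    also have "tr (transpose_mat ?L * (X * ?D)) = tr ((X * ?D) * transpose_mat ?L)"
      using X L by (intro tr_mult_comm[OF LT(1)]) (auto intro!: mult_carrier_mat[of _ n n])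
    also have "(X * ?D) * transpose_mat ?L = X * (?D * transpose_mat ?L)"
      by (rule assoc_mult_mat[OF X L(2) LT(1)])
    also have "Re (tr (X * (?L * transpose_mat ?D))) + Re (tr (X * (?D * transpose_mat ?L)))
        = Re (tr (X * (?D * transpose_mat ?L + ?L * transpose_mat ?D)))"
      using X XL by (simp add: mult_add_distrib_mat[OF X XL(6) XL(5)] tr_add[of _ n] mult_carrier_mat[OF X] del: assoc_mult_mat)
    also have "?D * transpose_mat ?L + ?L * transpose_mat ?D = cm (vtu_sq_deriv n x y)"
      unfolding vtu_sq_deriv_def by (simp add: cm_add[of _ n n] cm_mult[of _ n n _ n] cm_transpose mult_carrier_mat[of _ n n _ n])
    finally show ?thesis .
  qed
  then show ?thesis
    using Y vtu_sq_deriv by (simp add: tr_mult_pcomb)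
qed

section \<open>The reduced transfer function\<close>

lemma mult_smult_one:
  fixes X :: "'a::comm_ring_1 mat"
  assumes "X \<in> carrier_mat m n"
  shows "X * (c \<cdot>\<^sub>m 1\<^sub>m n) = c \<cdot>\<^sub>m X"
  using assms by (simp add: mult_smult_distrib[OF assms one_carrier_mat])

lemma outer_vuH_carrier: "outer_vuH v u \<in> carrier_mat (dim_vec v) (dim_vec u)"
  by (simp add: outer_vuH_def)

lemma tr_outer_vuH:
  assumes "X \<in> carrier_mat (dim_vec u) (dim_vec v)"
  shows "tr (outer_vuH v u * X) = (\<Sum>c<dim_vec u. \<Sum>b<dim_vec v. cnj (u $ c) * X $$ (c,b) * v $ b)"
  unfolding tr_mult[OF outer_vuH_carrier assms]
  by (subst sum.swap) (simp add: outer_vuH_def mult_ac)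

text \<open>With M v = a u, the form in the derivative of the singular value becomes a multiple of
  u^H X v = tr (v u^H X). The zero matrix is the derivative of the constant full-order
  value.\<close>

lemma quadratic_form_uminus_tr:
  assumes X: "X \<in> carrier_mat (dim_vec u) (dim_vec v)"
    and z: "\<And>c. c < dim_vec u \<Longrightarrow> z c = complex_of_real a * u $ c"
  shows "(\<Sum>c<dim_vec u. \<Sum>b<dim_vec v. cnj (z c) * (0\<^sub>m (dim_vec u) (dim_vec v) - X) $$ (c,b) * v $ b)
    = complex_of_real a * - tr (outer_vuH v u * X)"
  using X by (simp add: tr_outer_vuH z sum_distrib_left sum_negf mult.assoc)

lemma mat_deriv_Arp:
  fixes \<theta> :: "'a::real_normed_vector \<Rightarrow> nat \<Rightarrow> real"
  assumes \<theta>: "\<And>k. bounded_linear (\<lambda>x. \<theta> x k)"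
  shows "mat_deriv r r (\<lambda>y. Arp r nu ny \<kappa> fJ fR fQ p (\<theta> y))
    (\<lambda>h. (Jrp r nu ny \<kappa> fJ p (\<theta> h)
        - pcomb r r \<kappa> fR p (\<lambda>k. vtu_sq_deriv r (blk (\<theta> x) (offR r nu ny \<kappa> k)) (blk (\<theta> h) (offR r nu ny \<kappa> k))))
        * Qrp r nu ny \<kappa> fQ p (\<theta> x)
      + (Jrp r nu ny \<kappa> fJ p (\<theta> x) - Rrp r nu ny \<kappa> fR p (\<theta> x))
        * pcomb r r \<kappa> fQ p (\<lambda>k. vtu_sq_deriv r (blk (\<theta> x) (offQ r nu ny \<kappa> k)) (blk (\<theta> h) (offQ r nu ny \<kappa> k)))) x"
proof -
  note blk = bounded_linear_blk[of \<theta>, OF \<theta>]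
  have dJ: "mat_deriv r r (\<lambda>y. Jrp r nu ny \<kappa> fJ p (\<theta> y)) (\<lambda>h. Jrp r nu ny \<kappa> fJ p (\<theta> h)) x"
    unfolding Jrp_def Ji_def[abs_def]
    by (intro mat_deriv_pcomb mat_deriv_minus mat_deriv_transpose mat_deriv_vtsu blk)
  have dR: "mat_deriv r r (\<lambda>y. Rrp r nu ny \<kappa> fR p (\<theta> y))
      (\<lambda>h. pcomb r r \<kappa> fR p (\<lambda>k. vtu_sq_deriv r (blk (\<theta> x) (offR r nu ny \<kappa> k)) (blk (\<theta> h) (offR r nu ny \<kappa> k)))) x"
    unfolding Rrp_def Ri_def[abs_def] by (intro mat_deriv_pcomb mat_deriv_vtu_sq blk)
  have dQ: "mat_deriv r r (\<lambda>y. Qrp r nu ny \<kappa> fQ p (\<theta> y))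
      (\<lambda>h. pcomb r r \<kappa> fQ p (\<lambda>k. vtu_sq_deriv r (blk (\<theta> x) (offQ r nu ny \<kappa> k)) (blk (\<theta> h) (offQ r nu ny \<kappa> k)))) x"
    unfolding Qrp_def Qi_def[abs_def] by (intro mat_deriv_pcomb mat_deriv_vtu_sq blk)
  show ?thesis
    unfolding Arp_def by (intro mat_deriv_mult[of r r _ _ _ r] mat_deriv_minus dJ dR dQ)
qed

text \<open>The derivative is kept exactly as the calculus rules produce it, so that later
  statements match it verbatim. The maps for B, C and D are linear in the parameter and hence their
  own derivatives.\<close>

lemma mat_deriv_Hr:
  fixes \<theta> :: "'a::real_normed_vector \<Rightarrow> nat \<Rightarrow> real" and x :: 'a
    and fB fC fD fJ fR fQ :: "nat \<Rightarrow> 'p \<Rightarrow> real" and p :: 'p and s :: complex and r nu ny \<kappa> :: nat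
  assumes \<theta>: "\<And>k. bounded_linear (\<lambda>x. \<theta> x k)"
    and det: "Determinant.det (s \<cdot>\<^sub>m 1\<^sub>m r - cm (Arp r nu ny \<kappa> fJ fR fQ p (\<theta> x))) \<noteq> 0"
  defines "Dinv \<equiv> minv (s \<cdot>\<^sub>m 1\<^sub>m r - cm (Arp r nu ny \<kappa> fJ fR fQ p (\<theta> x)))"
    and "B \<equiv> cm (Brp r nu ny \<kappa> fB p (\<theta> x))" and "C \<equiv> cm (Crp r nu ny \<kappa> fC p (\<theta> x))"
    and "dA \<equiv> \<lambda>h. (Jrp r nu ny \<kappa> fJ p (\<theta> h)
        - pcomb r r \<kappa> fR p (\<lambda>k. vtu_sq_deriv r (blk (\<theta> x) (offR r nu ny \<kappa> k)) (blk (\<theta> h) (offR r nu ny \<kappa> k))))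
        * Qrp r nu ny \<kappa> fQ p (\<theta> x)
      + (Jrp r nu ny \<kappa> fJ p (\<theta> x) - Rrp r nu ny \<kappa> fR p (\<theta> x))
        * pcomb r r \<kappa> fQ p (\<lambda>k. vtu_sq_deriv r (blk (\<theta> x) (offQ r nu ny \<kappa> k)) (blk (\<theta> h) (offQ r nu ny \<kappa> k)))"
  shows "mat_deriv ny nu (\<lambda>y. Hr r nu ny \<kappa> fB fC fD fJ fR fQ s p (\<theta> y))
    (\<lambda>h. (cm (Crp r nu ny \<kappa> fC p (\<theta> h)) * Dinv + C * (- (Dinv * (0\<^sub>m r r - cm (dA h)) * Dinv))) * B
      + C * Dinv * cm (Brp r nu ny \<kappa> fB p (\<theta> h)) + cm (Drp r nu ny \<kappa> fD p (\<theta> h))) x"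
proof -
  note blk = bounded_linear_blk[of \<theta>, OF \<theta>]
  have dB: "mat_deriv r nu (\<lambda>y. Brp r nu ny \<kappa> fB p (\<theta> y)) (\<lambda>h. Brp r nu ny \<kappa> fB p (\<theta> h)) x"
    unfolding Brp_def Bi_def[abs_def] by (intro mat_deriv_pcomb mat_deriv_vtm blk)
  have dC: "mat_deriv ny r (\<lambda>y. Crp r nu ny \<kappa> fC p (\<theta> y)) (\<lambda>h. Crp r nu ny \<kappa> fC p (\<theta> h)) x"
    unfolding Crp_def Ci_def[abs_def] by (intro mat_deriv_pcomb mat_deriv_vtm blk)
  have dD: "mat_deriv ny nu (\<lambda>y. Drp r nu ny \<kappa> fD p (\<theta> y)) (\<lambda>h. Drp r nu ny \<kappa> fD p (\<theta> h)) x"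
    unfolding Drp_def Di_def[abs_def] by (intro mat_deriv_pcomb mat_deriv_vtm blk)
  have "mat_deriv r r (\<lambda>y. Arp r nu ny \<kappa> fJ fR fQ p (\<theta> y)) dA x"
    unfolding dA_def by (rule mat_deriv_Arp[where \<theta> = \<theta>, OF \<theta>])
  then have "mat_deriv r r (\<lambda>y. s \<cdot>\<^sub>m 1\<^sub>m r - cm (Arp r nu ny \<kappa> fJ fR fQ p (\<theta> y))) (\<lambda>h. 0\<^sub>m r r - cm (dA h)) x"
    by (intro mat_deriv_minus mat_deriv_const mat_deriv_cm) auto
  then have dDelta: "mat_deriv r r (\<lambda>y. minv (s \<cdot>\<^sub>m 1\<^sub>m r - cm (Arp r nu ny \<kappa> fJ fR fQ p (\<theta> y))))
      (\<lambda>h. - (Dinv * (0\<^sub>m r r - cm (dA h)) * Dinv)) x"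
    unfolding Dinv_def using det by (rule mat_deriv_minv)
  show ?thesis
    unfolding Hr_def B_def C_def using mat_deriv_add[OF mat_deriv_mult[OF mat_deriv_mult[OF mat_deriv_cm[OF dC] dDelta]
      mat_deriv_cm[OF dB]] mat_deriv_cm[OF dD]] unfolding Dinv_def .
qed

text \<open>Cyclicity of the trace moves each increment to the right end; what stands in front of it
  is the matrix from which gradient blocks are read. \<open>A'\<close> enters with a plus sign, as
  the minus of the derivative of the inverse cancels that of s I - A.\<close>

lemma tr_transfer_derivative:
  fixes W :: "'a::comm_ring_1 mat"
  assumes W: "W \<in> carrier_mat nu ny" and C: "C \<in> carrier_mat ny r" and Dinv: "Dinv \<in> carrier_mat r r"
    and B: "B \<in> carrier_mat r nu" and C': "C' \<in> carrier_mat ny r" and A': "A' \<in> carrier_mat r r"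
    and B': "B' \<in> carrier_mat r nu" and D': "D' \<in> carrier_mat ny nu"
  shows "tr (W * ((C' * Dinv + C * (- (Dinv * (0\<^sub>m r r - A') * Dinv))) * B + C * Dinv * B' + D'))
    = tr (Dinv * B * W * C') + tr (Dinv * B * W * C * Dinv * A') + tr (W * C * Dinv * B') + tr (W * D')"
proof -
  define P where "P = C * Dinv"
  define Q where "Q = Dinv * B"
  have P: "P \<in> carrier_mat ny r" and Q: "Q \<in> carrier_mat r nu"
    using C Dinv B by (auto simp: P_def Q_def)
  have X: "C' * Q \<in> carrier_mat ny nu" "P * A' * Q \<in> carrier_mat ny nu" "P * B' \<in> carrier_mat ny nu"
    "P * A' \<in> carrier_mat ny r" "W * P \<in> carrier_mat nu r" "Q * W \<in> carrier_mat r ny"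
    "C' * Dinv \<in> carrier_mat ny r"
    using P Q C' A' B' W Dinv by (auto intro!: mult_carrier_mat)
  have "0\<^sub>m r r - A' = - A'" using A' by auto
  then have "- (Dinv * (0\<^sub>m r r - A') * Dinv) = Dinv * A' * Dinv"
    using Dinv A' by auto
  then have "C * (- (Dinv * (0\<^sub>m r r - A') * Dinv)) = P * A' * Dinv"
    using C Dinv A' by (simp add: P_def assoc_mult_mat[of _ _ r _ r _ r])
  then have "(C' * Dinv + C * (- (Dinv * (0\<^sub>m r r - A') * Dinv))) * B = C' * Q + P * A' * Q"
    using C' Dinv B X(4,7) by (simp add: Q_def add_mult_distrib_mat[OF X(7) mult_carrier_mat[OF X(4) Dinv] B]
        assoc_mult_mat[OF C' Dinv B] assoc_mult_mat[OF X(4) Dinv B] del: assoc_mult_mat)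
  then have "tr (W * ((C' * Dinv + C * (- (Dinv * (0\<^sub>m r r - A') * Dinv))) * B + C * Dinv * B' + D'))
      = tr (W * (C' * Q + P * A' * Q + P * B' + D'))"
    by (simp add: P_def)
  also have "\<dots> = tr (W * (C' * Q)) + tr (W * (P * A' * Q)) + tr (W * (P * B')) + tr (W * D')"
    using W D' X mult_carrier_mat[OF W X(1)] mult_carrier_mat[OF W X(2)] mult_carrier_mat[OF W X(3)] mult_carrier_mat[OF W D']
    by (simp add: mult_add_distrib_mat[of _ nu ny _ nu] tr_add[of _ nu] del: assoc_mult_mat)
  also have "tr (W * (C' * Q)) = tr (Q * W * C')"
  proof -
    have "tr (W * (C' * Q)) = tr ((C' * Q) * W)" by (rule tr_mult_comm[OF W X(1)])
    also have "\<dots> = tr (C' * (Q * W))" by (simp only: assoc_mult_mat[OF C' Q W])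
    also have "\<dots> = tr (Q * W * C')" by (rule tr_mult_comm[OF C' X(6)])
    finally show ?thesis .
  qed
  also have "tr (W * (P * A' * Q)) = tr (Q * W * P * A')"
  proof -
    have "tr (W * (P * A' * Q)) = tr ((P * A' * Q) * W)" by (rule tr_mult_comm[OF W X(2)])
    also have "(P * A' * Q) * W = P * A' * (Q * W)" by (rule assoc_mult_mat[OF X(4) Q W])
    also have "tr (P * A' * (Q * W)) = tr (Q * W * (P * A'))" by (rule tr_mult_comm[OF X(4) X(6)])
    also have "Q * W * (P * A') = Q * W * P * A'" by (rule assoc_mult_mat[OF X(6) P A', symmetric])
    finally show ?thesis .
  qed
  also have "Q * W * P = Dinv * B * W * C * Dinv"
    unfolding Q_def[symmetric] P_def by (rule assoc_mult_mat[OF X(6) C Dinv, symmetric])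
  also have "W * (P * B') = W * C * Dinv * B'"
    using assoc_mult_mat[OF W P B'] assoc_mult_mat[OF W C Dinv] by (simp add: P_def)
  finally show ?thesis
    by (simp add: Q_def)
qed

lemma grad_formula_pairing:
  fixes \<theta>0 \<eta> :: "nat \<Rightarrow> real" and u v :: "complex Matrix.vec"
    and fB fC fD fJ fR fQ :: "nat \<Rightarrow> 'p \<Rightarrow> real" and p :: 'p and s :: complex and r nu ny \<kappa> :: nat
  defines "A \<equiv> Arp r nu ny \<kappa> fJ fR fQ p \<theta>0"
  defines "Dinv \<equiv> minv (s \<cdot>\<^sub>m 1\<^sub>m r - cm A)"
    and "B \<equiv> cm (Brp r nu ny \<kappa> fB p \<theta>0)" and "C \<equiv> cm (Crp r nu ny \<kappa> fC p \<theta>0)"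
    and "dA \<equiv> (Jrp r nu ny \<kappa> fJ p \<eta>
        - pcomb r r \<kappa> fR p (\<lambda>k. vtu_sq_deriv r (blk \<theta>0 (offR r nu ny \<kappa> k)) (blk \<eta> (offR r nu ny \<kappa> k))))
        * Qrp r nu ny \<kappa> fQ p \<theta>0
      + (Jrp r nu ny \<kappa> fJ p \<theta>0 - Rrp r nu ny \<kappa> fR p \<theta>0)
        * pcomb r r \<kappa> fQ p (\<lambda>k. vtu_sq_deriv r (blk \<theta>0 (offQ r nu ny \<kappa> k)) (blk \<eta> (offQ r nu ny \<kappa> k)))"
    and "W \<equiv> outer_vuH v u"
  assumes u: "dim_vec u = ny" and v: "dim_vec v = nu"
  shows "pairing (grad_formula r nu ny \<kappa> fB fC fD fJ fR fQ s p \<theta>0 u v) \<eta>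
    = - Re (tr (W * ((cm (Crp r nu ny \<kappa> fC p \<eta>) * Dinv + C * (- (Dinv * (0\<^sub>m r r - cm dA) * Dinv))) * B
      + C * Dinv * cm (Brp r nu ny \<kappa> fB p \<eta>) + cm (Drp r nu ny \<kappa> fD p \<eta>))))" (is ?pairing)
    and "length (grad_formula r nu ny \<kappa> fB fC fD fJ fR fQ s p \<theta>0 u v) = ntheta r nu ny \<kappa>" (is ?length)
proof -
  define J where "J = Jrp r nu ny \<kappa> fJ p \<theta>0"
  define R where "R = Rrp r nu ny \<kappa> fR p \<theta>0"
  define Q where "Q = Qrp r nu ny \<kappa> fQ p \<theta>0"
  define J' where "J' = Jrp r nu ny \<kappa> fJ p \<eta>"
  define R' where "R' = pcomb r r \<kappa> fR p (\<lambda>k. vtu_sq_deriv r (blk \<theta>0 (offR r nu ny \<kappa> k)) (blk \<eta> (offR r nu ny \<kappa> k)))"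
  define Q' where "Q' = pcomb r r \<kappa> fQ p (\<lambda>k. vtu_sq_deriv r (blk \<theta>0 (offQ r nu ny \<kappa> k)) (blk \<eta> (offQ r nu ny \<kappa> k)))"
  have W: "W \<in> carrier_mat nu ny"
    using outer_vuH_carrier[of v u] u v by (simp add: W_def)
  have JRQ: "J \<in> carrier_mat r r" "R \<in> carrier_mat r r" "Q \<in> carrier_mat r r"
    "J' \<in> carrier_mat r r" "R' \<in> carrier_mat r r" "Q' \<in> carrier_mat r r"
    by (simp_all add: J_def R_def Q_def J'_def R'_def Q'_def Jrp_def Rrp_def Qrp_def)
  have JR: "J - R \<in> carrier_mat r r" "J' - R' \<in> carrier_mat r r"
    using JRQ by (auto intro: minus_carrier_mat)
  have A: "A \<in> carrier_mat r r"
    using JR JRQ by (simp add: A_def Arp_def J_def R_def Q_def)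
  have dA: "dA = (J' - R') * Q + (J - R) * Q'"
    by (simp add: dA_def J_def R_def Q_def J'_def R'_def Q'_def)
  have dAc: "dA \<in> carrier_mat r r"
    using JR JRQ unfolding dA by (auto intro!: mult_carrier_mat)
  have Dinv: "Dinv \<in> carrier_mat r r"
    unfolding Dinv_def using A by (intro minv_carrier minus_carrier_mat) auto
  have B: "B \<in> carrier_mat r nu" and C: "C \<in> carrier_mat ny r"
    and B': "cm (Brp r nu ny \<kappa> fB p \<eta>) \<in> carrier_mat r nu"
    and C': "cm (Crp r nu ny \<kappa> fC p \<eta>) \<in> carrier_mat ny r"
    and D': "cm (Drp r nu ny \<kappa> fD p \<eta>) \<in> carrier_mat ny nu"
    by (simp_all add: B_def C_def Brp_def Crp_def Drp_def)
  define Z where "Z = Dinv * B * W * C * Dinv"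
  define Y1 where "Y1 = cm Q * Dinv * B * W * C * Dinv"
  define Y2 where "Y2 = Z * (cm J - cm R)"
  have DB: "Dinv * B \<in> carrier_mat r nu" "Dinv * B * W \<in> carrier_mat r ny" "Dinv * B * W * C \<in> carrier_mat r r"
    and WC: "W * C \<in> carrier_mat nu r" "W * C * Dinv \<in> carrier_mat nu r"
    and Z: "Z \<in> carrier_mat r r"
    using Dinv B C W by (auto simp: Z_def intro!: mult_carrier_mat)
  have Y1_eq: "Y1 = cm Q * Z"
  proof -
    have Qc: "cm Q \<in> carrier_mat r r" using JRQ by simp
    show ?thesis
      unfolding Y1_def Z_def assoc_mult_mat[OF Qc DB(3) Dinv, symmetric] assoc_mult_mat[OF Qc DB(2) C, symmetric]
        assoc_mult_mat[OF Qc DB(1) W, symmetric] assoc_mult_mat[OF Qc Dinv B, symmetric] ..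
  qed
  have Y: "Y1 \<in> carrier_mat r r" "Y2 \<in> carrier_mat r r"
    using Z JRQ by (auto simp: Y1_eq Y2_def intro!: mult_carrier_mat minus_carrier_mat)
  \<comment> \<open>From the product rule for A = (J - R) Q: cycling Q to the front makes Y1 = Q Z
    the coefficient of the increments of J and R, while Y2 = Z (J - R) is that of the increment of
    Q.\<close>
  have trA: "tr (Z * cm dA) = tr (Y1 * cm J') - tr (Y1 * cm R') + tr (Y2 * cm Q')"
  proof -
    have c: "cm J \<in> carrier_mat r r" "cm R \<in> carrier_mat r r" "cm Q \<in> carrier_mat r r"
      "cm J' \<in> carrier_mat r r" "cm R' \<in> carrier_mat r r" "cm Q' \<in> carrier_mat r r"
      "cm J - cm R \<in> carrier_mat r r" "cm J' - cm R' \<in> carrier_mat r r"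
      using JRQ by (auto intro!: minus_carrier_mat)
    have m: "(cm J' - cm R') * cm Q \<in> carrier_mat r r" "(cm J - cm R) * cm Q' \<in> carrier_mat r r"
      "Z * (cm J' - cm R') \<in> carrier_mat r r" "Y1 * cm J' \<in> carrier_mat r r" "Y1 * cm R' \<in> carrier_mat r r"
      using c Y Z by (auto intro!: mult_carrier_mat)
    have "cm dA = (cm J' - cm R') * cm Q + (cm J - cm R) * cm Q'"
      unfolding dA using JRQ JR
      by (simp add: cm_add[of _ r r] cm_mult[of _ r r _ r] cm_minus[of _ r r] mult_carrier_mat[of _ r r _ r])
    then have "tr (Z * cm dA) = tr (Z * ((cm J' - cm R') * cm Q)) + tr (Z * ((cm J - cm R) * cm Q'))"
      using Z m by (simp add: mult_add_distrib_mat[OF Z m(1,2)] tr_add[of _ r] mult_carrier_mat[OF Z] del: assoc_mult_mat)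
    also have "Z * ((cm J - cm R) * cm Q') = Y2 * cm Q'"
      unfolding Y2_def by (rule assoc_mult_mat[OF Z c(7,6), symmetric])
    also have "Z * ((cm J' - cm R') * cm Q) = Z * (cm J' - cm R') * cm Q"
      by (rule assoc_mult_mat[OF Z c(8,3), symmetric])
    also have "tr (Z * (cm J' - cm R') * cm Q) = tr (cm Q * (Z * (cm J' - cm R')))"
      by (rule tr_mult_comm[OF m(3) c(3)])
    also have "cm Q * (Z * (cm J' - cm R')) = Y1 * (cm J' - cm R')"
      unfolding Y1_eq by (rule assoc_mult_mat[OF c(3) Z c(8), symmetric])
    also have "tr (Y1 * (cm J' - cm R')) = tr (Y1 * cm J') - tr (Y1 * cm R')"
      using m by (simp add: mult_minus_distrib_mat[OF Y(1) c(4,5)] tr_minus[of _ r])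
    finally show ?thesis .
  qed
  define gB where "gB k = map (\<lambda>z. - Re z) (ftv (transpose_mat (complex_of_real (fB k p) \<cdot>\<^sub>m (W * C * Dinv))))" for k
  define gC where "gC k = map (\<lambda>z. - Re z) (ftv (transpose_mat (complex_of_real (fC k p) \<cdot>\<^sub>m (Dinv * B * W))))" for k
  define gD where "gD k = map (\<lambda>z. - Re z) (ftv (transpose_mat (complex_of_real (fD k p) \<cdot>\<^sub>m W)))" for k
  define gJ where "gJ k = map2 (\<lambda>a b. Re (a - b)) (sutv (complex_of_real (fJ k p) \<cdot>\<^sub>m Y1))
      (sutv (transpose_mat (complex_of_real (fJ k p) \<cdot>\<^sub>m Y1)))" for k
  define gR where "gR k = map Re (utv ((complex_of_real (fR k p) \<cdot>\<^sub>m Y1) * cm (vtu r (blk \<theta>0 (offR r nu ny \<kappa> k)))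
      + transpose_mat (complex_of_real (fR k p) \<cdot>\<^sub>m Y1) * cm (vtu r (blk \<theta>0 (offR r nu ny \<kappa> k)))))" for k
  \<comment> \<open>The two summands are swapped against \<open>grad_formula\<close>, so that the
    lemma for the R blocks applies; \<open>comm_add_mat\<close> reconciles them below.\<close>
  define gQ where "gQ k = map (\<lambda>z. - Re z) (utv ((complex_of_real (fQ k p) \<cdot>\<^sub>m Y2) * cm (vtu r (blk \<theta>0 (offQ r nu ny \<kappa> k)))
      + transpose_mat (complex_of_real (fQ k p) \<cdot>\<^sub>m Y2) * cm (vtu r (blk \<theta>0 (offQ r nu ny \<kappa> k)))))" for k
  have L: "cm (vtu r w) \<in> carrier_mat r r" for w
    by (simp add: vtu_def)
  have YL: "(c \<cdot>\<^sub>m Y) * cm (vtu r w) \<in> carrier_mat r r" "transpose_mat (c \<cdot>\<^sub>m Y) * cm (vtu r w) \<in> carrier_mat r r"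
    if "Y \<in> carrier_mat r r" for c w Y
    using that L by (auto intro!: mult_carrier_mat)
  have grad: "grad_formula r nu ny \<kappa> fB fC fD fJ fR fQ s p \<theta>0 u v
      = concat (map gB [0..<\<kappa>]) @ concat (map gC [0..<\<kappa>]) @ concat (map gD [0..<\<kappa>])
        @ concat (map gJ [0..<\<kappa>]) @ concat (map gR [0..<\<kappa>]) @ concat (map gQ [0..<\<kappa>])"
    unfolding gB_def gC_def gD_def gJ_def gR_def gQ_def comm_add_mat[OF YL[OF Y(2)]]
      mult_smult_one[OF WC(2), symmetric] mult_smult_one[OF DB(2), symmetric]
    unfolding Y1_def Y2_def Z_def W_def B_def C_def Dinv_def A_def J_def R_def Q_def
    unfolding grad_formula_def Let_def ..
  have len: "length (gB k) = nB r nu" "length (gC k) = nC r ny" "length (gD k) = nD nu ny"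
    "length (gJ k) = nJ r" "length (gR k) = nRQ r" "length (gQ k) = nRQ r" for k
    using W WC DB Y YL
    by (simp_all add: gB_def gC_def gD_def gJ_def gR_def gQ_def nB_def nC_def nD_def nJ_def nRQ_def
        length_utv[of _ r] length_sutv[of _ r] carrier_matD[OF W] carrier_matD[OF WC(2)] carrier_matD[OF DB(2)]
        del: index_mult_mat)
  show ?length
    unfolding grad by (simp add: length_concat_map_upt len ntheta_def algebra_simps)
  \<comment> \<open>The prefix lengths of the six groups, and of the blocks inside each group, are
    the offsets \<open>offB\<close> to \<open>offQ\<close>.\<close>
  have "pairing (grad_formula r nu ny \<kappa> fB fC fD fJ fR fQ s p \<theta>0 u v) \<eta>
      = (\<Sum>k<\<kappa>. pairing (gB k) (blk \<eta> (offB r nu ny \<kappa> k)))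
      + (\<Sum>k<\<kappa>. pairing (gC k) (blk \<eta> (offC r nu ny \<kappa> k)))
      + (\<Sum>k<\<kappa>. pairing (gD k) (blk \<eta> (offD r nu ny \<kappa> k)))
      + (\<Sum>k<\<kappa>. pairing (gJ k) (blk \<eta> (offJ r nu ny \<kappa> k)))
      + (\<Sum>k<\<kappa>. pairing (gR k) (blk \<eta> (offR r nu ny \<kappa> k)))
      + (\<Sum>k<\<kappa>. pairing (gQ k) (blk \<eta> (offQ r nu ny \<kappa> k)))"
    unfolding grad pairing_append
    by (simp add: pairing_concat_blocks[OF len(1)] pairing_concat_blocks[OF len(2)] pairing_concat_blocks[OF len(3)]
        pairing_concat_blocks[OF len(4)] pairing_concat_blocks[OF len(5)] pairing_concat_blocks[OF len(6)]
        length_concat_map_upt len blk_def offB_def offC_def offD_def offJ_def offR_def offQ_def algebra_simps)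
  also have "(\<Sum>k<\<kappa>. pairing (gB k) (blk \<eta> (offB r nu ny \<kappa> k))) = - Re (tr (W * C * Dinv * cm (Brp r nu ny \<kappa> fB p \<eta>)))"
    unfolding gB_def Brp_def Bi_def[abs_def] by (rule pairing_blocks_vtm[OF WC(2)])
  also have "(\<Sum>k<\<kappa>. pairing (gC k) (blk \<eta> (offC r nu ny \<kappa> k))) = - Re (tr (Dinv * B * W * cm (Crp r nu ny \<kappa> fC p \<eta>)))"
    unfolding gC_def Crp_def Ci_def[abs_def] by (rule pairing_blocks_vtm[OF DB(2)])
  also have "(\<Sum>k<\<kappa>. pairing (gD k) (blk \<eta> (offD r nu ny \<kappa> k))) = - Re (tr (W * cm (Drp r nu ny \<kappa> fD p \<eta>)))"
    unfolding gD_def Drp_def Di_def[abs_def] by (rule pairing_blocks_vtm[OF W])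
  also have "(\<Sum>k<\<kappa>. pairing (gJ k) (blk \<eta> (offJ r nu ny \<kappa> k))) = - Re (tr (Y1 * cm J'))"
    unfolding gJ_def J'_def Jrp_def Ji_def[abs_def] by (rule pairing_blocks_skew[OF Y(1)])
  also have "(\<Sum>k<\<kappa>. pairing (gR k) (blk \<eta> (offR r nu ny \<kappa> k))) = Re (tr (Y1 * cm R'))"
    unfolding gR_def R'_def by (rule pairing_blocks_sq[OF Y(1)])
  also have "(\<Sum>k<\<kappa>. pairing (gQ k) (blk \<eta> (offQ r nu ny \<kappa> k))) = - Re (tr (Y2 * cm Q'))"
    unfolding gQ_def Q'_def pairing_uminus sum_negf
    by (rule arg_cong[of _ _ uminus], rule pairing_blocks_sq[OF Y(2)])
  finally show ?pairing
    unfolding tr_transfer_derivative[OF W C Dinv B C' cm_carrier[OF dAc] B' D'] Z_def[symmetric] trA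
    by simp
qed


section \<open>The singular value of the error as a function of the parameter\<close>

lemma sigma_error_derivative:
  fixes \<theta> :: "'a::real_normed_vector \<Rightarrow> nat \<Rightarrow> real"
    and fB fC fD fJ fR fQ :: "nat \<Rightarrow> 'p \<Rightarrow> real"
    and p :: 'p and s :: complex and r nu ny \<kappa> :: nat and u v :: "complex Matrix.vec"
  assumes \<theta>: "\<And>k. bounded_linear (\<lambda>x. \<theta> x k)"
    and H0: "H0 \<in> carrier_mat ny nu"
    and inv: "invertible_mat (s \<cdot>\<^sub>m 1\<^sub>m r - cm (Arp r nu ny \<kappa> fJ fR fQ p (\<theta> x)))"
    and j: "1 \<le> j" "j \<le> nu"
  defines "E \<equiv> \<lambda>y. H0 - Hr r nu ny \<kappa> fB fC fD fJ fR fQ s p (\<theta> y)"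
  assumes nonzero: "sigma j (E x) \<noteq> 0"
    and simple: "count (mset (sing_vals (E x))) (sigma j (E x)) = 1"
    and uv: "sing_vec_pair (E x) (sigma j (E x)) u v"
  shows "\<forall>\<^sub>F y in nhds x. (\<lambda>y. sigma j (E y)) differentiable (at y)" (is ?nbhd)
    and "((\<lambda>y. sigma j (E y)) has_derivative
      (\<lambda>h. pairing (grad_formula r nu ny \<kappa> fB fC fD fJ fR fQ s p (\<theta> x) u v) (\<theta> h))) (at x)" (is ?deriv)
    and "length (grad_formula r nu ny \<kappa> fB fC fD fJ fR fQ s p (\<theta> x) u v) = ntheta r nu ny \<kappa>" (is ?length)
proof -
  define Delta where "Delta y = s \<cdot>\<^sub>m 1\<^sub>m r - cm (Arp r nu ny \<kappa> fJ fR fQ p (\<theta> y))" for y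
  \<comment> \<open>Some derivative at every \<open>y\<close> yields both the shape of
    \<open>Delta\<close> and the continuity of its determinant at \<open>x\<close>.\<close>
  have Delta: "\<exists>D'. mat_deriv r r Delta D' y" for y
    unfolding Delta_def
    by (rule exI, rule mat_deriv_minus[OF mat_deriv_const mat_deriv_cm[OF mat_deriv_Arp[where \<theta> = \<theta>, OF \<theta>]]]) simp
  then have Delta_carrier: "Delta y \<in> carrier_mat r r" for y
    using mat_derivD(1) by blast
  have det: "Determinant.det (Delta x) \<noteq> 0"
    using inv invertible_mat_iff_det[OF Delta_carrier] by (simp add: Delta_def)
  note dHr = mat_deriv_Hr[where \<theta> = \<theta> and s = s and r = r and nu = nu and ny = ny and \<kappa> = \<kappa> and p = p
      and fB = fB and fC = fC and fD = fD and fJ = fJ and fR = fR and fQ = fQ, OF \<theta>, folded Delta_def]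
  note dE = mat_deriv_minus[OF mat_deriv_const[OF H0] dHr, folded E_def]
  have E: "E y \<in> carrier_mat ny nu" for y
    by (rule mat_derivD(1)[OF dE[OF det]])
  define k where "k = j - 1"
  have k: "k < nu" using j by (simp add: k_def)
  have sigma: "sigma j (E y) = sing_vals (E y) ! k" for y
    by (simp add: sigma_def k_def)
  note nonzero' = nonzero[unfolded sigma] and simple' = simple[unfolded sigma]

  have "((\<lambda>y. Determinant.det (Delta y)) \<longlongrightarrow> Determinant.det (Delta x)) (at x)"
    using Delta[of x] mat_deriv_tendsto by (intro tendsto_det[where n = r] Delta_carrier) blast
  then have "\<forall>\<^sub>F y in nhds x. Determinant.det (Delta y) \<noteq> 0"
    using det by (auto simp: eventually_nhds_conv_at dest: tendsto_imp_eventually_ne)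
  moreover have "\<forall>\<^sub>F y in nhds x. sing_vals (E y) ! k \<noteq> 0 \<and>
      count (mset (sing_vals (E y))) (sing_vals (E y) ! k) = 1"
    by (rule eventually_sing_val_simple[OF E mat_deriv_tendsto[OF dE[OF det]] k nonzero' simple'])
  \<comment> \<open>Every nearby \<open>y\<close> again satisfies the pointwise hypotheses, so the
    differentiability result applies there with \<open>y\<close> in place of
    \<open>x\<close>.\<close>
  ultimately show ?nbhd
  proof eventually_elim
    case (elim y)
    have "(\<lambda>y. E y $$ (c,b)) differentiable (at y)" if "c < ny" "b < nu" for c b
      using mat_derivD(3)[OF dE[OF elim(1)] that] by (auto simp: differentiable_def)
    then show ?case
      unfolding sigma using elim(2) by (intro sing_val_differentiable[where Mf = E, OF E _ k]) auto
  qed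

  have uv': "dim_vec u = ny" "dim_vec v = nu" "vnorm2 v = 1"
    "E x *\<^sub>v v = complex_of_real (sigma j (E x)) \<cdot>\<^sub>v u" "cadj (E x) *\<^sub>v u = complex_of_real (sigma j (E x)) \<cdot>\<^sub>v v"
    using uv E[of x] by (auto simp: sing_vec_pair_def)
  have v_carrier: "v \<in> carrier_vec nu" using uv'(2) by auto
  have V: "(\<Sum>a<nu. (cmod (v $ a))\<^sup>2) = 1"
    using uv'(2,3) by (simp add: vnorm2_def)
  have Ev: "(\<Sum>a<nu. E x $$ (c,a) * v $ a) = complex_of_real (sigma j (E x)) * u $ c" if "c < ny" for c
    using arg_cong[OF uv'(4), of "\<lambda>w. w $ c"] that uv'(1,2) E[of x]
    by (simp add: scalar_prod_def lessThan_atLeast0)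
  \<comment> \<open>Both equations of the singular pair are combined: E^H E v = sigma E^H u =
    sigma^2 v.\<close>
  have "(cadj (E x) * E x) *\<^sub>v v = cadj (E x) *\<^sub>v (E x *\<^sub>v v)"
    by (rule assoc_mult_mat_vec[OF cadj_carrier[OF E] E v_carrier])
  also have "\<dots> = complex_of_real (sigma j (E x)) \<cdot>\<^sub>v (cadj (E x) *\<^sub>v u)"
    unfolding uv'(4) using uv'(1) by (intro mult_mat_vec[OF cadj_carrier[OF E]]) auto
  also have "\<dots> = complex_of_real ((sigma j (E x))\<^sup>2) \<cdot>\<^sub>v v"
    unfolding uv'(5) by (auto simp: power2_eq_square)
  finally have NN: "(cadj (E x) * E x) *\<^sub>v v = complex_of_real ((sigma j (E x))\<^sup>2) \<cdot>\<^sub>v v" .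
  have N: "(\<Sum>b<nu. (cadj (E x) * E x) $$ (a,b) * v $ b) = complex_of_real ((sing_vals (E x) ! k)\<^sup>2) * v $ a"
    if "a < nu" for a
    using arg_cong[OF NN, of "\<lambda>w. w $ a"] that uv'(2) carrier_matD[OF gram_carrier[OF E, of x]]
    by (simp add: scalar_prod_def lessThan_atLeast0 sigma del: index_mult_mat assoc_mult_mat)
  have v0: "\<exists>a<nu. v $ a \<noteq> 0"
    using V by (metis (no_types, lifting) lessThan_iff norm_zero power_zero_numeral sum.neutral zero_neq_one)
  let ?X = "\<lambda>h. (cm (Crp r nu ny \<kappa> fC p (\<theta> h)) * minv (Delta x) + cm (Crp r nu ny \<kappa> fC p (\<theta> x)) *
      (- (minv (Delta x) * (0\<^sub>m r r - cm ((Jrp r nu ny \<kappa> fJ p (\<theta> h)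
        - pcomb r r \<kappa> fR p (\<lambda>k. vtu_sq_deriv r (blk (\<theta> x) (offR r nu ny \<kappa> k)) (blk (\<theta> h) (offR r nu ny \<kappa> k))))
        * Qrp r nu ny \<kappa> fQ p (\<theta> x)
      + (Jrp r nu ny \<kappa> fJ p (\<theta> x) - Rrp r nu ny \<kappa> fR p (\<theta> x))
        * pcomb r r \<kappa> fQ p (\<lambda>k. vtu_sq_deriv r (blk (\<theta> x) (offQ r nu ny \<kappa> k)) (blk (\<theta> h) (offQ r nu ny \<kappa> k))))) * minv (Delta x))))
      * cm (Brp r nu ny \<kappa> fB p (\<theta> x))
      + cm (Crp r nu ny \<kappa> fC p (\<theta> x)) * minv (Delta x) * cm (Brp r nu ny \<kappa> fB p (\<theta> h)) + cm (Drp r nu ny \<kappa> fD p (\<theta> h))"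
  let ?E' = "\<lambda>h. 0\<^sub>m ny nu - ?X h"
  have "((\<lambda>y. sigma j (E y)) has_derivative
    (\<lambda>h. Re (\<Sum>c<ny. \<Sum>b<nu. cnj (\<Sum>a<nu. E x $$ (c,a) * v $ a) * ?E' h $$ (c,b) * v $ b)
      / (sing_vals (E x) ! k * (\<Sum>a<nu. (cmod (v $ a))\<^sup>2)))) (at x)"
    unfolding sigma
    by (rule sing_val_has_derivative[where v = "\<lambda>a. v $ a", OF E mat_derivD(3)[OF dE[OF det]] k nonzero' simple' v0 N])
  moreover have "Re (\<Sum>c<ny. \<Sum>b<nu. cnj (\<Sum>a<nu. E x $$ (c,a) * v $ a) * ?E' h $$ (c,b) * v $ b)
      / (sing_vals (E x) ! k * (\<Sum>a<nu. (cmod (v $ a))\<^sup>2))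
      = pairing (grad_formula r nu ny \<kappa> fB fC fD fJ fR fQ s p (\<theta> x) u v) (\<theta> h)" for h
  proof -
    have X: "?X h \<in> carrier_mat ny nu"
      by (rule mat_derivD(2)[OF dHr[OF det]])
    have "(\<Sum>c<ny. \<Sum>b<nu. cnj (\<Sum>a<nu. E x $$ (c,a) * v $ a) * ?E' h $$ (c,b) * v $ b)
        = complex_of_real (sigma j (E x)) * - tr (outer_vuH v u * ?X h)"
      by (rule quadratic_form_uminus_tr[of "?X h" u v "\<lambda>c. \<Sum>a<nu. E x $$ (c,a) * v $ a" "sigma j (E x)",
            unfolded uv'(1,2), OF X Ev])
    then have "Re (\<Sum>c<ny. \<Sum>b<nu. cnj (\<Sum>a<nu. E x $$ (c,a) * v $ a) * ?E' h $$ (c,b) * v $ b)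
        = sigma j (E x) * - Re (tr (outer_vuH v u * ?X h))"
      by (simp only: times_complex.sel uminus_complex.sel Re_complex_of_real Im_complex_of_real mult_zero_left diff_zero)
    \<comment> \<open>The factor sigma coming from E v = sigma u cancels the one in the denominator,
      and ||v|| = 1 removes the rest.\<close>
    then show ?thesis
      using nonzero unfolding V grad_formula_pairing(1)[OF uv'(1,2)] Delta_def[symmetric] by (simp add: sigma)
  qed
  ultimately show ?deriv by simp
  show ?length by (rule grad_formula_pairing(2)[OF uv'(1,2)])
qed

unbundle vec_syntax

theorem theorem3p8:
  fixes H :: "complex \<Rightarrow> real^'p \<Rightarrow> complex mat"
    and \<Omega> :: "(real^'p) set"
    and r nu ny \<kappa> :: nat
    and fB fC fD fJ fR fQ :: "nat \<Rightarrow> real^'p \<Rightarrow> real"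
    and ix :: "nat \<Rightarrow> 'n::finite"
    and \<theta>0 :: "real^'n"
    and s0 :: complex and p0 :: "real^'p"
    and j :: nat and u v :: "complex vec"
  assumes H_dim: "\<forall>s p. 0 \<le> Re s \<and> p \<in> \<Omega> \<longrightarrow> H s p \<in> carrier_mat ny nu"
    and ix: "bij_betw ix {..<ntheta r nu ny \<kappa>} UNIV"
    and s0: "0 \<le> Re s0" and p0: "p0 \<in> \<Omega>"
    and Delta_inv: "invertible_mat (s0 \<cdot>\<^sub>m 1\<^sub>m r
                      - cm (Arp r nu ny \<kappa> fJ fR fQ p0 (\<lambda>k. \<theta>0 $ ix k)))"
    and j: "1 \<le> j" "j \<le> min ny nu"
    and nonzero: "sigma j (H s0 p0 - Hr r nu ny \<kappa> fB fC fD fJ fR fQ s0 p0 (\<lambda>k. \<theta>0 $ ix k)) \<noteq> 0"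
    and simple: "count (mset (sing_vals (H s0 p0 - Hr r nu ny \<kappa> fB fC fD fJ fR fQ s0 p0 (\<lambda>k. \<theta>0 $ ix k))))
                   (sigma j (H s0 p0 - Hr r nu ny \<kappa> fB fC fD fJ fR fQ s0 p0 (\<lambda>k. \<theta>0 $ ix k))) = 1"
    and uv: "sing_vec_pair (H s0 p0 - Hr r nu ny \<kappa> fB fC fD fJ fR fQ s0 p0 (\<lambda>k. \<theta>0 $ ix k))
               (sigma j (H s0 p0 - Hr r nu ny \<kappa> fB fC fD fJ fR fQ s0 p0 (\<lambda>k. \<theta>0 $ ix k))) u v"
  shows "(\<exists>e>0. \<forall>x\<in>ball \<theta>0 e.
            (\<lambda>x. sigma j (H s0 p0 - Hr r nu ny \<kappa> fB fC fD fJ fR fQ s0 p0 (\<lambda>k. x $ ix k)))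
              differentiable (at x))
       \<and> ((\<lambda>x. sigma j (H s0 p0 - Hr r nu ny \<kappa> fB fC fD fJ fR fQ s0 p0 (\<lambda>k. x $ ix k)))
            has_derivative
            (\<lambda>h. \<Sum>k<ntheta r nu ny \<kappa>.
                   grad_formula r nu ny \<kappa> fB fC fD fJ fR fQ s0 p0 (\<lambda>k. \<theta>0 $ ix k) u v ! k * h $ ix k))
          (at \<theta>0)"
proof -
  \<comment> \<open>The numbering \<open>ix\<close> turns a point of \<open>real^'n\<close> into a
    parameter sequence whose entries are bounded linear in the point, as the abstract result
    requires.\<close>
  define \<theta> where "\<theta> x k = x $ ix k" for x :: "real^'n" and k
  have \<theta>: "bounded_linear (\<lambda>x. \<theta> x k)" for k
    unfolding \<theta>_def by (rule bounded_linear_vec_nth)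
  have H0: "H s0 p0 \<in> carrier_mat ny nu"
    using H_dim s0 p0 by blast
  have jn: "j \<le> nu" using j by simp
  have eta: "(\<lambda>k. x $ ix k) = \<theta> x" for x :: "real^'n"
    by (simp add: \<theta>_def fun_eq_iff)
  note main = sigma_error_derivative[where \<theta> = \<theta>, OF \<theta> H0 Delta_inv[unfolded eta] j(1) jn nonzero[unfolded eta]
      simple[unfolded eta] uv[unfolded eta]]
  have "\<exists>e>0. \<forall>x\<in>ball \<theta>0 e.
      (\<lambda>x. sigma j (H s0 p0 - Hr r nu ny \<kappa> fB fC fD fJ fR fQ s0 p0 (\<theta> x))) differentiable (at x)"
    using main(1) unfolding eventually_nhds_metric by (auto simp: dist_commute)
  then show ?thesis
    unfolding eta using main(2) unfolding pairing_def main(3) by (auto simp: \<theta>_def)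
qed

end
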